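(* (i) Let $S\equiv\pm\{1, 4, 7, 10, 11, 13, 17, 18, 19, 24, 25, 27\}\pmod{60}$ and $T\equiv\pm\{1, 3, 7, 10, 11, 16, 17, 18, 23, 24, 25, 29\}\pmod{60}$. Then $p(S,n)=p(T,n-1)$ for all $n\geq 1$. (ii) Let $S\equiv\pm\{1, 5, 6, 7, 8, 10, 11, 12, 17, 19, 21, 23\}\pmod{60}$ and $T\equiv\pm\{1, 5, 6, 7, 9, 10, 11, 12, 13, 17, 28, 29\}\pmod{60}$. Then $p(S,n)=p(T,n)$ for all integers $n\ge0$ with $n\neq 8$. (iii) Let $S\equiv\pm\{6, 7, 8, 9, 10, 11, 12, 13, 19, 23, 25, 29\}\pmod{60}$ and $T\equiv\pm\{1, 6, 10, 12, 13, 17, 19, 21, 23, 25, 28, 29\}\pmod{60}$. Then $p(S,n)=p(T,n-6)$ for all $n\geq 6$. (iv) Let $S\equiv\pm\{3, 4, 5, 10, 11, 13, 17, 18, 19, 23, 24, 29\}\pmod{60}$ and $T\equiv\pm\{1, 5, 7, 10, 13, 16, 18, 19, 23, 24, 27, 29\}\pmod{60}$. Then $p(S,n)=p(T,n-3)$ for all $n\geq 3$.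
   Context: For a set $S$ of positive integers and an integer $n\ge 0$, $p(S,n)$ denotes the number of partitions of $n$ into parts belonging to $S$ (so $p(S,0)=1$). The notation $S\equiv\pm\{r_1,\dots,r_k\}\pmod M$ means that $S$ is the set of all positive integers $n$ such that $n\equiv r_i$ or $n\equiv -r_i\pmod M$ for some $i$. *)

theory Defs
  imports Complex_Main "HOL-Library.Multiset" "HOL-Number_Theory.Cong"
begin

(* A partition is the multiset of its parts.  The set counted is finite when 0 is not in S;
   otherwise card would yield 0. *)
definition num_partitions :: "nat set \<Rightarrow> nat \<Rightarrow> nat" where
  "num_partitions S n = card {P :: nat multiset. set_mset P \<subseteq> S \<and> sum_mset P = n}"

definition pm_residues :: "int set \<Rightarrow> int \<Rightarrow> nat set" where
  "pm_residues R M =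
     {n. n > 0 \<and> (\<exists>r\<in>R. [int n = r] (mod M) \<or> [int n = - r] (mod M))}"

end

theory Submission
  imports Defs "HOL-Complex_Analysis.Complex_Analysis"
begin

text \<open>
  Up to powers of \<open>q\<close>, each of the four identities says that \<open>U(S) - U(T) = 1\<close>, where \<open>U(R)\<close> is the
  reciprocal of the product of the Siegel functions \<open>g(s/60, 0)\<close>, \<open>s \<in> R\<close>, at \<open>60\<tau>\<close>. All \<open>U(R)\<close> are
  modular functions of weight zero. Replacing the vector \<open>(s/60, 0)\<close> by \<open>s (c, d)/60\<close> gives a family of
  functions \<open>U(S) - U(T) - 1\<close> indexed by the primitive vectors \<open>(c, d)\<close> modulo 60, which SL(2, Z) permutes
  transitively. The identities (i)--(iv) are the members with \<open>d = 0\<close> and \<open>c = 1, 7, 13, 19\<close>, so it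
  suffices that one member vanishes identically. The product of all members is invariant under SL(2, Z)
  and holomorphic on the upper half plane. At \<open>i\<infinity>\<close> the members with \<open>gcd(c, 60) > 1\<close> contribute a pole of
  total order at most 36, whereas the coefficients of the partition generating functions up to degree 8
  already show that those with \<open>gcd(c, 60) = 1\<close> contribute a zero of order at least 40.
  Hence the product tends to zero at \<open>i\<infinity>\<close> and is zero by the maximum modulus principle.
\<close>

section \<open>Infinite products\<close>

text \<open>The four identities have to be proved together. Multiplying the indices by a unit modulo
  60 carries the pair of (i), up to signs of the residues, to the pair of one of (i)-(iv), and the
  unit 11 exchanges the two sets of (i) while changing both signs. So the 8 units modulo sign meet
  each identity twice. Treating one identity alone would require expansions at all cusps of a curve
  of level 60; the product over all vectors trades these for the single cusp of level one, and only
  crude pole bounds are then needed. The margin is thin: 28 of the 40 come from (iii), where seven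
  coefficients vanish because the smallest part of its set S is 6. Eta functions are avoided: the
  multiplier of the inversion is needed only through its 12th power, since every set has twelve
  residues, and this power can be read off from the three points of order two.\<close>

definition qpoch :: "complex \<Rightarrow> complex \<Rightarrow> complex" where
  "qpoch a q = (\<Prod>n. 1 - a * q ^ n)"

lemma convergent_prod_qpoch:
  fixes a q :: complex
  assumes "norm q < 1"
  shows "convergent_prod (\<lambda>n. 1 - a * q ^ n)"
proof -
  have "summable (\<lambda>n. norm a * norm q ^ n)"
    using assms by (intro summable_mult summable_geometric) auto
  moreover have "norm ((1 - a * q ^ n) - 1) = norm a * norm q ^ n" for n
    by (simp add: norm_mult norm_power)
  ultimately have "summable (\<lambda>n. norm ((1 - a * q ^ n) - 1))" by presburger
  thus ?thesis
    by (intro abs_convergent_prod_imp_convergent_prod summable_imp_abs_convergent_prod)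
qed

lemma qpoch_LIMSEQ:
  fixes a q :: complex
  assumes "norm q < 1"
  shows "(\<lambda>m. \<Prod>n<m. 1 - a * q ^ n) \<longlonglongrightarrow> qpoch a q"
  using convergent_prod_has_prod[OF convergent_prod_qpoch[OF assms, of a]]
  by (auto simp: qpoch_def intro: has_prod_imp_tendsto')

lemma qpoch_Suc:
  assumes "norm q < 1"
  shows "qpoch a q = (1 - a) * qpoch (a * q) q"
proof (rule LIMSEQ_unique[OF LIMSEQ_Suc[OF qpoch_LIMSEQ[OF assms]]])
  have "(\<lambda>m. (1 - a) * (\<Prod>n<m. 1 - a * q * q ^ n)) \<longlonglongrightarrow> (1 - a) * qpoch (a * q) q"
    by (intro tendsto_intros qpoch_LIMSEQ assms)
  also have "(\<lambda>m. (1 - a) * (\<Prod>n<m. 1 - a * q * q ^ n)) = (\<lambda>m. \<Prod>n<Suc m. 1 - a * q ^ n)"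
    by (subst prod.lessThan_Suc_shift) (simp add: mult_ac)
  finally show "(\<lambda>m. \<Prod>n<Suc m. 1 - a * q ^ n) \<longlonglongrightarrow> (1 - a) * qpoch (a * q) q" .
qed

lemma qpoch_eq_0_iff:
  assumes "norm q < 1"
  shows "qpoch a q = 0 \<longleftrightarrow> (\<exists>n. a * q ^ n = 1)"
proof -
  have "(\<lambda>n. 1 - a * q ^ n) has_prod qpoch a q"
    unfolding qpoch_def by (intro convergent_prod_has_prod convergent_prod_qpoch assms)
  from has_prod_eq_0_iff[OF this] show ?thesis by force
qed

text \<open>Each factor is at least 1 - |a| |q|^n in norm, so the real positive arguments
  \<open>\<alpha>\<close>, \<open>\<rho>\<close> are the worst case. The resulting bound is uniform
  in \<open>a\<close> and \<open>q\<close>, as needed for Siegel functions near the cusp.\<close>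

lemma qpoch_norm_le:
  assumes "norm a \<le> \<alpha>" "\<alpha> < 1" "norm q \<le> \<rho>" "\<rho> < 1"
  shows "norm (qpoch (of_real \<alpha>) (of_real \<rho>)) \<le> norm (qpoch a q)"
proof (rule LIMSEQ_le)
  have ge: "0 \<le> \<alpha>" "0 \<le> \<rho>" using assms norm_ge_zero order_trans by blast+
  show "(\<lambda>m. norm (\<Prod>n<m. 1 - complex_of_real \<alpha> * of_real \<rho> ^ n)) \<longlonglongrightarrow>
          norm (qpoch (of_real \<alpha>) (of_real \<rho>))"
    using assms ge by (intro tendsto_norm qpoch_LIMSEQ) auto
  show "(\<lambda>m. norm (\<Prod>n<m. 1 - a * q ^ n)) \<longlonglongrightarrow> norm (qpoch a q)"
    using assms by (intro tendsto_norm qpoch_LIMSEQ) auto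
  have "norm (1 - complex_of_real \<alpha> * of_real \<rho> ^ n) \<le> norm (1 - a * q ^ n)" for n
  proof -
    have "\<alpha> * \<rho> ^ n \<le> 1 * 1 ^ n"
      using assms ge by (intro mult_mono power_mono) auto
    have "1 - complex_of_real \<alpha> * of_real \<rho> ^ n = of_real (1 - \<alpha> * \<rho> ^ n)" by simp
    hence "norm (1 - complex_of_real \<alpha> * of_real \<rho> ^ n) = \<bar>1 - \<alpha> * \<rho> ^ n\<bar>"
      by (metis norm_of_real)
    also have "\<dots> = 1 - \<alpha> * \<rho> ^ n" using \<open>\<alpha> * \<rho> ^ n \<le> 1 * 1 ^ n\<close> by simp
    also have "\<dots> \<le> 1 - norm (a * q ^ n)"
      using assms ge by (auto simp: norm_mult norm_power intro!: mult_mono power_mono)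
    also have "\<dots> \<le> norm (1 - a * q ^ n)"
      using norm_triangle_ineq2[of 1 "a * q ^ n"] by simp
    finally show ?thesis .
  qed
  thus "\<exists>N. \<forall>m\<ge>N. norm (\<Prod>n<m. 1 - complex_of_real \<alpha> * of_real \<rho> ^ n) \<le> norm (\<Prod>n<m. 1 - a * q ^ n)"
    by (auto simp flip: prod_norm intro!: prod_mono)
qed

lemma holomorphic_on_qpoch [holomorphic_intros]:
  assumes f: "f holomorphic_on A" and g: "g holomorphic_on A" and A: "open A"
    and g1: "\<And>z. z \<in> A \<Longrightarrow> norm (g z) < 1"
  shows "(\<lambda>z. qpoch (f z) (g z)) holomorphic_on A"
proof (rule holomorphic_uniform_sequence[OF A])
  show "(\<lambda>z. \<Prod>n<m. 1 - f z * g z ^ n) holomorphic_on A" for m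
    using f g by (intro holomorphic_intros)
next
  fix x assume x: "x \<in> A"
  obtain d where d: "d > 0" "cball x d \<subseteq> A"
    using A x open_contains_cball by blast
  let ?C = "cball x d"
  have cf: "continuous_on ?C f" and cg: "continuous_on ?C g"
    using f g d holomorphic_on_imp_continuous_on continuous_on_subset by blast+
  have "compact (f ` ?C)" using cf by (intro compact_continuous_image) auto
  then obtain B where B: "\<And>z. z \<in> ?C \<Longrightarrow> norm (f z) \<le> B"
    using compact_imp_bounded bounded_iff by (metis imageI)
  have "continuous_on ?C (\<lambda>z. norm (g z))" using cg by (intro continuous_intros)
  then obtain y where y: "y \<in> ?C" "\<And>z. z \<in> ?C \<Longrightarrow> norm (g z) \<le> norm (g y)"
    using continuous_attains_sup[of ?C "\<lambda>z. norm (g z)"] d by auto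
  define r where "r = norm (g y)"
  have r: "0 \<le> r" "r < 1" using y d g1 unfolding r_def by auto
  have B0: "0 \<le> B" using B[of x] d by (smt (verit) centre_in_cball norm_ge_zero)
  have "uniformly_convergent_on ?C (\<lambda>N z. \<Sum>n<N. norm (- f z * g z ^ n))"
  proof (rule Weierstrass_m_test')
    show "norm (norm (- f z * g z ^ n)) \<le> B * r ^ n" if "z \<in> ?C" for n z
      using B[OF that] y(2)[OF that] B0
      by (auto simp: norm_mult norm_power r_def intro!: mult_mono power_mono)
    show "summable (\<lambda>n. B * r ^ n)" using r by (intro summable_mult summable_geometric) auto
  qed
  hence "uniformly_convergent_on ?C (\<lambda>N z. \<Prod>n<N. 1 + - f z * g z ^ n)"
    using cf cg by (intro uniformly_convergent_on_prod continuous_intros) auto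
  then obtain l where l: "uniform_limit ?C (\<lambda>N z. \<Prod>n<N. 1 - f z * g z ^ n) l sequentially"
    unfolding uniformly_convergent_on_def by auto
  have "l z = qpoch (f z) (g z)" if "z \<in> ?C" for z
    using LIMSEQ_unique[OF tendsto_uniform_limitI[OF l that] qpoch_LIMSEQ] g1 that d by blast
  hence "uniform_limit ?C (\<lambda>N z. \<Prod>n<N. 1 - f z * g z ^ n) (\<lambda>z. qpoch (f z) (g z)) sequentially"
    using l by (subst uniform_limit_cong') auto
  thus "\<exists>d>0. cball x d \<subseteq> A \<and>
      uniform_limit (cball x d) (\<lambda>N z. \<Prod>n<N. 1 - f z * g z ^ n) (\<lambda>z. qpoch (f z) (g z)) sequentially"
    using d by blast
qed

lemma qpoch_mult_minus:
  assumes "norm q < 1"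
  shows "qpoch a q * qpoch (- a) q = qpoch (a\<^sup>2) (q\<^sup>2)"
proof (rule LIMSEQ_unique)
  show "(\<lambda>m. (\<Prod>n<m. 1 - a * q ^ n) * (\<Prod>n<m. 1 - (- a) * q ^ n)) \<longlonglongrightarrow> qpoch a q * qpoch (- a) q"
    by (intro tendsto_intros qpoch_LIMSEQ assms)
  have "(\<lambda>m. (\<Prod>n<m. 1 - a * q ^ n) * (\<Prod>n<m. 1 - (- a) * q ^ n)) =
        (\<lambda>m. \<Prod>n<m. 1 - a\<^sup>2 * (q\<^sup>2) ^ n)"
    by (simp add: prod.distrib [symmetric] algebra_simps power2_eq_square power_mult_distrib)
  moreover have "norm (q\<^sup>2) < 1"
    using assms by (simp add: norm_power power_less_one_iff)
  ultimately show "(\<lambda>m. (\<Prod>n<m. 1 - a * q ^ n) * (\<Prod>n<m. 1 - (- a) * q ^ n)) \<longlonglongrightarrow> qpoch (a\<^sup>2) (q\<^sup>2)"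
    using qpoch_LIMSEQ by simp
qed

text \<open>Euler's identity between odd parts and distinct parts: (q; q^2) (q^2; q^2) = (q; q) by
  parity of the exponent and (q; q) (-q; q) = (q^2; q^2) factor by factor; the nonzero (q; q) then
  cancels.\<close>

lemma qpoch_euler:
  assumes "norm q < 1"
  shows "qpoch q (q\<^sup>2) * qpoch (- q) q = 1"
proof -
  have q2: "norm (q\<^sup>2) < 1"
    using assms by (simp add: norm_power power_less_one_iff)
  have 2: "qpoch q (q\<^sup>2) * qpoch (q\<^sup>2) (q\<^sup>2) = qpoch q q"
  proof (rule LIMSEQ_unique)
    show "(\<lambda>m. (\<Prod>n<m. 1 - q * (q\<^sup>2) ^ n) * (\<Prod>n<m. 1 - q\<^sup>2 * (q\<^sup>2) ^ n)) \<longlonglongrightarrow>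
             qpoch q (q\<^sup>2) * qpoch (q\<^sup>2) (q\<^sup>2)"
      by (intro tendsto_intros qpoch_LIMSEQ q2)
    have eq: "(\<Prod>n<m. 1 - q * (q\<^sup>2) ^ n) * (\<Prod>n<m. 1 - q\<^sup>2 * (q\<^sup>2) ^ n) = (\<Prod>n<2*m. 1 - q * q ^ n)" for m
    proof (induction m)
      case (Suc m)
      have "(\<Prod>n<2 * Suc m. 1 - q * q ^ n) = (\<Prod>n<2*m. 1 - q * q ^ n) * (1 - q * (q\<^sup>2)^m) * (1 - q\<^sup>2 * (q\<^sup>2) ^ m)"
        unfolding power_mult[of q 2 m, symmetric]
        by (simp add: power2_eq_square mult.assoc)
      thus ?case unfolding Suc[symmetric] by simp
    qed simp
    have "filterlim (\<lambda>m::nat. 2 * m) at_top at_top"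
      by (rule filterlim_subseq) (auto simp: strict_mono_def)
    from filterlim_compose[OF qpoch_LIMSEQ[OF assms, of q] this]
    show "(\<lambda>m. (\<Prod>n<m. 1 - q * (q\<^sup>2) ^ n) * (\<Prod>n<m. 1 - q\<^sup>2 * (q\<^sup>2) ^ n)) \<longlonglongrightarrow> qpoch q q"
      unfolding eq .
  qed
  have "q * q ^ n \<noteq> 1" for n
  proof
    assume "q * q ^ n = 1"
    hence "norm q ^ Suc n = 1" by (metis norm_one norm_power power_Suc)
    thus False using assms power_less_one_iff[of "norm q" "Suc n"] by simp
  qed
  hence "qpoch q q \<noteq> 0" using qpoch_eq_0_iff[OF assms] by simp
  moreover have "qpoch q q * (qpoch q (q\<^sup>2) * qpoch (- q) q) = qpoch q q"
    using qpoch_mult_minus[OF assms, of q] 2 by (metis mult.assoc mult.commute)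
  ultimately show ?thesis by (metis mult_cancel_left1 mult.commute mult_cancel_left2)
qed

section \<open>The theta function\<close>

definition ei :: "complex \<Rightarrow> complex" where
  "ei z = exp (of_real pi * \<i> * z)"

lemma ei_add: "ei (x + y) = ei x * ei y"
  and ei_diff: "ei (x - y) = ei x / ei y"
  and ei_minus: "ei (- x) = inverse (ei x)"
  by (simp_all add: ei_def ring_distribs exp_add exp_diff exp_minus)

lemma ei_0 [simp]: "ei 0 = 1" and ei_nonzero [simp]: "ei z \<noteq> 0"
  by (simp_all add: ei_def)

lemma ei_1 [simp]: "ei 1 = -1"
  by (simp add: ei_def)

lemma ei_power: "ei z ^ n = ei (of_nat n * z)"
  by (simp add: ei_def mult_ac flip: exp_of_nat_mult)

lemma norm_ei: "norm (ei z) = exp (- pi * Im z)"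
  by (simp add: ei_def)

lemma ei_eq_1_iff: "ei z = 1 \<longleftrightarrow> (\<exists>k::int. z = 2 * of_int k)"
  unfolding ei_def exp_eq_1 by (auto simp: complex_eq_iff)

lemma ei_of_int: "ei (of_int n) = (if even n then 1 else -1)"
proof (cases "even n")
  case True
  thus ?thesis using ei_eq_1_iff[of "of_int n"] by (auto elim!: evenE)
next
  case False
  then obtain k where k: "n = 2 * k + 1" by (elim oddE)
  have "ei (2 * of_int k) = 1" using ei_eq_1_iff by blast
  thus ?thesis using k by (simp add: ei_add)
qed

lemma holomorphic_on_ei [holomorphic_intros]:
  "f holomorphic_on A \<Longrightarrow> (\<lambda>z. ei (f z)) holomorphic_on A"
  unfolding ei_def by (intro holomorphic_intros)

text \<open>Jacobi's theta function \<theta>_1 without its factors that depend on \<open>t\<close>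
  alone, namely, up to a constant, ei(t/4) and the product of all 1 - ei(2nt).\<close>

definition psi :: "complex \<Rightarrow> complex \<Rightarrow> complex" where
  "psi z t = ei (- z) * qpoch (ei (2 * z)) (ei (2 * t)) * qpoch (ei (2 * t - 2 * z)) (ei (2 * t))"

lemma norm_ei_less_1: "Im t > 0 \<Longrightarrow> norm (ei (2 * t)) < 1"
  by (simp add: norm_ei)

text \<open>This form isolates the zero at the origin in the odd factor; the remaining two products
  together are even in \<open>z\<close>.\<close>

lemma psi_alt:
  assumes "Im t > 0"
  shows "psi z t = (ei (- z) - ei z) * qpoch (ei (2 * t + 2 * z)) (ei (2 * t)) * qpoch (ei (2 * t - 2 * z)) (ei (2 * t))"
proof -
  have "ei (- z) * (1 - ei (2 * z)) = ei (- z) - ei (- z + 2 * z)"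
    by (simp only: ei_add ring_distribs) simp
  thus ?thesis
    unfolding psi_def qpoch_Suc[OF norm_ei_less_1[OF assms], of "ei (2 * z)"]
    by (simp add: ei_add mult_ac)
qed

lemma psi_minus: "Im t > 0 \<Longrightarrow> psi (- z) t = - psi z t"
  by (simp add: psi_alt algebra_simps)

lemma psi_plus_1: "psi (z + 1) t = - psi z t"
proof -
  have "ei 2 = 1" using ei_eq_1_iff[of 2] by (auto intro: exI[of _ 1])
  thus ?thesis by (simp add: psi_def ei_add ei_minus ei_diff ring_distribs)
qed

lemma psi_plus_period:
  assumes "Im t > 0"
  shows "psi (z + t) t = - ei (- t - 2 * z) * psi z t"
proof -
  have 1: "qpoch (ei (- 2 * z)) (ei (2 * t)) = (1 - ei (- 2 * z)) * qpoch (ei (2 * t - 2 * z)) (ei (2 * t))"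
    unfolding qpoch_Suc[OF norm_ei_less_1[OF assms], of "ei (- 2 * z)"]
    by (simp add: ei_add ei_diff ei_minus field_simps)
  have "ei (- (z + t)) * (1 - ei (- 2 * z)) = - ei (- t - 2 * z) * (ei (- z) - ei z)"
    by (simp add: ei_def algebra_simps flip: exp_add)
  moreover have "psi (z + t) t = (ei (- (z + t)) * (1 - ei (- 2 * z))) *
      (qpoch (ei (2 * t + 2 * z)) (ei (2 * t)) * qpoch (ei (2 * t - 2 * z)) (ei (2 * t)))"
  proof -
    have arg: "2 * (z + t) = 2 * t + 2 * z" "2 * t - (2 * t + 2 * z) = - 2 * z" by simp_all
    show ?thesis unfolding psi_def arg 1 by (simp only: mult_ac)
  qed
  ultimately show ?thesis
    unfolding psi_alt[OF assms, of z] by (simp add: mult.assoc)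
qed

lemma psi_eq_0_iff:
  assumes "Im t > 0"
  shows "psi z t = 0 \<longleftrightarrow> (\<exists>m n :: int. z = of_int m + of_int n * t)"
proof -
  have q: "norm (ei (2 * t)) < 1" using norm_ei_less_1[OF assms] .
  have 1: "qpoch (ei (2 * z)) (ei (2 * t)) = 0 \<longleftrightarrow> (\<exists>(n::nat) (k::int). z = of_int k - of_nat n * t)"
    unfolding qpoch_eq_0_iff[OF q] ei_power ei_add[symmetric] ei_eq_1_iff
    by (intro ex_cong1) (auto simp: algebra_simps complex_eq_iff)
  have 2: "qpoch (ei (2 * t - 2 * z)) (ei (2 * t)) = 0 \<longleftrightarrow> (\<exists>(n::nat) (k::int). z = of_nat (Suc n) * t - of_int k)"
    unfolding qpoch_eq_0_iff[OF q] ei_power ei_add[symmetric] ei_eq_1_iff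
    by (intro ex_cong1) (auto simp: algebra_simps complex_eq_iff)
  show ?thesis
  proof
    assume "psi z t = 0"
    hence "(\<exists>(n::nat) (k::int). z = of_int k - of_nat n * t) \<or> (\<exists>(n::nat) (k::int). z = of_nat (Suc n) * t - of_int k)"
      using 1 2 by (auto simp: psi_def)
    thus "\<exists>m n :: int. z = of_int m + of_int n * t"
    proof (elim disjE exE)
      fix n :: nat and k :: int assume "z = of_int k - of_nat n * t"
      thus ?thesis by (intro exI[of _ k] exI[of _ "- int n"]) simp
    next
      fix n :: nat and k :: int assume "z = of_nat (Suc n) * t - of_int k"
      thus ?thesis by (intro exI[of _ "-k"] exI[of _ "int (Suc n)"]) simp
    qed
  next
    assume "\<exists>m n :: int. z = of_int m + of_int n * t"
    then obtain m n :: int where z: "z = of_int m + of_int n * t" by auto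
    show "psi z t = 0"
    proof (cases "n \<le> 0")
      case True
      hence "z = of_int m - of_nat (nat (- n)) * t" using z by simp
      thus ?thesis using 1 by (auto simp: psi_def)
    next
      case False
      hence "z = of_nat (Suc (nat (n - 1))) * t - of_int (- m)" using z
        by (simp add: Suc_nat_eq_nat_zadd1)
      hence "qpoch (ei (2 * t - 2 * z)) (ei (2 * t)) = 0" unfolding 2 by blast
      thus ?thesis by (simp add: psi_def)
    qed
  qed
qed

lemma holomorphic_on_psi [holomorphic_intros]:
  assumes "f holomorphic_on A" "g holomorphic_on A" "open A" "\<And>z. z \<in> A \<Longrightarrow> Im (g z) > 0"
  shows "(\<lambda>z. psi (f z) (g z)) holomorphic_on A"
  unfolding psi_def using assms by (intro holomorphic_intros norm_ei_less_1) auto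

lemma deriv_psi_nonzero:
  assumes "Im t > 0"
  shows "deriv (\<lambda>z. psi z t) 0 \<noteq> 0"
proof -
  define X where "X = (\<lambda>z. qpoch (ei (2 * t + 2 * z)) (ei (2 * t)) * qpoch (ei (2 * t - 2 * z)) (ei (2 * t)))"
  have q: "norm (ei (2 * t)) < 1" using norm_ei_less_1[OF assms] .
  have "X holomorphic_on UNIV"
    unfolding X_def using q by (intro holomorphic_intros) auto
  then obtain X' where X': "(X has_field_derivative X') (at 0)"
    by (metis holomorphic_on_open iso_tuple_UNIV_I open_UNIV)
  have "(ei has_field_derivative of_real pi * \<i> * ei z) (at z)" for z
    unfolding ei_def[abs_def] by (auto intro!: derivative_eq_intros)
  note DERIV_chain2[OF this, derivative_intros]
  have "((\<lambda>z. (ei (- z) - ei z) * X z) has_field_derivative (- 2 * of_real pi * \<i> * X 0)) (at 0)"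
    by (rule derivative_eq_intros refl X' | simp)+
  hence "deriv (\<lambda>z. psi z t) 0 = - 2 * of_real pi * \<i> * X 0"
    using psi_alt[OF assms] by (intro DERIV_imp_deriv) (simp add: X_def mult.assoc)
  moreover have "ei (2 * t) * ei (2 * t) ^ n \<noteq> 1" for n
  proof
    assume "ei (2 * t) * ei (2 * t) ^ n = 1"
    hence "norm (ei (2 * t)) ^ Suc n = 1" by (metis norm_one norm_power power_Suc)
    thus False using q power_less_one_iff[of "norm (ei (2 * t))" "Suc n"] by simp
  qed
  hence "X 0 \<noteq> 0" unfolding X_def using qpoch_eq_0_iff[OF q] by simp
  ultimately show ?thesis by simp
qed

text \<open>The multipliers agree, so A/B is doubly periodic. Quasi-periodicity spreads the zero of
  \<open>A\<close> at 0 over the lattice, where \<open>B\<close> has only simple zeros; hence A/B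
  extends to an entire function and Liouville's theorem applies.\<close>

lemma quasi_elliptic_unique:
  fixes A B :: "complex \<Rightarrow> complex"
  assumes t: "Im t > 0" and hA: "A holomorphic_on UNIV" and hB: "B holomorphic_on UNIV"
    and A1: "\<And>z. A (z + 1) = - A z" and B1: "\<And>z. B (z + 1) = - B z"
    and At: "\<And>z. A (z + t) = - ei (- t - 2 * z) * A z"
    and Bt: "\<And>z. B (z + t) = - ei (- t - 2 * z) * B z"
    and B0: "\<And>z. B z = 0 \<longleftrightarrow> (\<exists>m n :: int. z = of_int m + of_int n * t)"
    and A0: "A 0 = 0" and B': "deriv B 0 \<noteq> 0"
  shows "\<exists>c. \<forall>z. A z = c * B z"
proof -
  have B00: "B 0 = 0" unfolding B0 by (rule exI[of _ 0])+ simp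
  \<comment> \<open>The zero at the origin is divided out: \<open>a\<close> and \<open>b\<close> are
    entire, and A/B = a/b near 0.\<close>
  define a where "a = (\<lambda>z. if z = 0 then deriv A 0 else A z / z)"
  define b where "b = (\<lambda>z. if z = 0 then deriv B 0 else B z / z)"
  have a: "a holomorphic_on UNIV" and b: "b holomorphic_on UNIV"
    using pole_lemma_open[OF hA, of 0] pole_lemma_open[OF hB, of 0]
    by (simp_all add: a_def b_def A0 B00 cong: if_cong)
  \<comment> \<open>One common value on all lattice points keeps \<open>Q\<close> doubly periodic,
    so differentiability has to be checked only at 0.\<close>
  define Q where "Q z = (if B z = 0 then a 0 / b 0 else A z / B z)" for z
  have Q1: "Q (z + 1) = Q z" for z by (simp add: Q_def A1 B1)
  have Qt: "Q (z + t) = Q z" for z by (simp add: Q_def At Bt)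
  have Qm: "Q (z + of_int m) = Q z" for z and m :: int
  proof (induction m rule: int_induct[where k = 0])
    case (step1 i) thus ?case using Q1[of "z + of_int i"] by (simp add: add_ac)
  next
    case (step2 i) thus ?case using Q1[of "z + of_int (i - 1)"] by (simp add: add_ac)
  qed simp
  have Qn: "Q (z + of_int n * t) = Q z" for z and n :: int
  proof (induction n rule: int_induct[where k = 0])
    case (step1 i) thus ?case using Qt[of "z + of_int i * t"] by (simp add: algebra_simps)
  next
    case (step2 i) thus ?case using Qt[of "z + of_int (i - 1) * t"] by (simp add: algebra_simps)
  qed simp
  have Qmn: "Q (z + (of_int m + of_int n * t)) = Q z" for z and m n :: int
    using Qm[of "z + of_int n * t" m] Qn[of z n] by (simp add: add_ac)
  have op: "open {z. f z \<noteq> 0}" if "f holomorphic_on UNIV" for f :: "complex \<Rightarrow> complex"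
    using that by (intro open_Collect_neq continuous_on_const holomorphic_on_imp_continuous_on)
  have Qb: "Q holomorphic_on {z. b z \<noteq> 0}"
  proof (rule holomorphic_transform)
    show "(\<lambda>z. a z / b z) holomorphic_on {z. b z \<noteq> 0}"
      by (intro holomorphic_intros holomorphic_on_subset[OF a] holomorphic_on_subset[OF b]) auto
    show "a z / b z = Q z" if "z \<in> {z. b z \<noteq> 0}" for z
      using that B00 by (auto simp: Q_def a_def b_def)
  qed
  have QB: "Q holomorphic_on {z. B z \<noteq> 0}"
  proof (rule holomorphic_transform)
    show "(\<lambda>z. A z / B z) holomorphic_on {z. B z \<noteq> 0}"
      by (intro holomorphic_intros holomorphic_on_subset[OF hA] holomorphic_on_subset[OF hB]) auto
  qed (auto simp: Q_def)
  have "Q field_differentiable at z" for z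
  proof (cases "B z = 0")
    case False
    thus ?thesis using holomorphic_on_imp_differentiable_at[OF QB op[OF hB]] by simp
  next
    case True
    then obtain m n :: int where z: "z = of_int m + of_int n * t" using B0 by auto
    have "b 0 \<noteq> 0" using B' by (simp add: b_def)
    hence "Q field_differentiable at 0"
      using holomorphic_on_imp_differentiable_at[OF Qb op[OF b]] by simp
    then obtain D where "(Q has_field_derivative D) (at (z + - z))"
      by (auto simp: field_differentiable_def)
    hence "((\<lambda>x. Q (x + - z)) has_field_derivative D) (at z)"
      by (subst (asm) DERIV_shift) 
    moreover have "Q (x + - z) = Q x" for x
      using Qmn[of x "-m" "-n"] z by (simp add: algebra_simps)
    ultimately show ?thesis by (auto simp: field_differentiable_def)
  qed
  hence hQ: "Q holomorphic_on UNIV" by (simp add: holomorphic_on_def)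
  \<comment> \<open>The closed period parallelogram, on which \<open>Q\<close> takes all its
    values.\<close>
  define K where "K = (\<lambda>(x, y). complex_of_real x + of_real y * t) ` ({0..1} \<times> {0..1})"
  have "compact K" unfolding K_def
    by (intro compact_continuous_image compact_Times compact_Icc)
       (auto simp: case_prod_unfold intro!: continuous_intros)
  hence "bounded (Q ` K)"
    using hQ holomorphic_on_imp_continuous_on continuous_on_subset
    by (intro compact_imp_bounded compact_continuous_image) blast+
  moreover have "range Q \<subseteq> Q ` K"
  proof safe
    fix z
    define y where "y = Im z / Im t"
    define x where "x = Re z - y * Re t"
    have z: "z = of_real x + of_real y * t"
      using t by (simp add: complex_eq_iff x_def y_def)
    have "z + (of_int (- \<lfloor>x\<rfloor>) + of_int (- \<lfloor>y\<rfloor>) * t) = of_real (frac x) + of_real (frac y) * t"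
      unfolding z frac_def by (simp add: algebra_simps)
    moreover have "\<dots> \<in> K"
      unfolding K_def using frac_lt_1[of x] frac_lt_1[of y]
      by (intro image_eqI[of _ _ "(frac x, frac y)"]) (auto simp: less_imp_le)
    ultimately show "Q z \<in> Q ` K" using Qmn by (metis imageI)
  qed
  ultimately have "bounded (range Q)" using bounded_subset by blast
  from Liouville_theorem[OF hQ this] obtain c where c: "\<And>z. Q z = c"
    unfolding constant_on_def by auto
  have "A z = c * B z" for z
  proof (cases "B z = 0")
    case False thus ?thesis using c[of z] by (simp add: Q_def field_simps)
  next
    case True
    then obtain m n :: int where z: "z = of_int m + of_int n * t" using B0 by auto
    have "A (of_int m) = 0" for m
    proof (induction m rule: int_induct[where k = 0])
      case (step1 i) thus ?case using A1[of "of_int i"] by simp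
    next
      case (step2 i) thus ?case using A1[of "of_int (i - 1)"] by simp
    qed (simp add: A0)
    hence "A (of_int m + of_int n * t) = 0"
    proof (induction n rule: int_induct[where k = 0])
      case (step1 i) thus ?case using At[of "of_int m + of_int i * t"] by (simp add: algebra_simps)
    next
      case (step2 i) thus ?case using At[of "of_int m + of_int (i - 1) * t"] by (simp add: algebra_simps)
    qed simp
    thus ?thesis using True z by simp
  qed
  thus ?thesis by blast
qed

section \<open>Siegel functions\<close>

text \<open>The Gaussian factor converts the multipliers of psi(z/t, -1/t) under z + 1 and z + t
  into those of psi(z, t). The constant depends on \<open>t\<close> and is left undetermined
  here.\<close>

lemma psi_inversion:
  assumes t: "Im t > 0"
  shows "\<exists>c. \<forall>z. ei (- z\<^sup>2 / t) * psi (z / t) (- 1 / t) = c * psi z t"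
proof (rule quasi_elliptic_unique[OF t])
  have t0: "t \<noteq> 0" using t by auto
  have t': "Im (- 1 / t) > 0" using t by (simp add: Im_divide sum_power2_gt_zero_iff)
  show "(\<lambda>z. ei (- z\<^sup>2 / t) * psi (z / t) (- 1 / t)) holomorphic_on UNIV"
    using t' t0 by (intro holomorphic_intros) auto
  show "(\<lambda>z. psi z t) holomorphic_on UNIV"
    using t by (intro holomorphic_intros) auto
  fix z
  show "psi (z + 1) t = - psi z t" by (rule psi_plus_1)
  show "psi (z + t) t = - ei (- t - 2 * z) * psi z t" by (rule psi_plus_period[OF t])
  have "psi (z / t) (- 1 / t) = - ei (- 1 / t - 2 * (z / t)) * psi ((z + 1) / t) (- 1 / t)"
    using psi_plus_period[OF t', of "(z + 1) / t"] t0 by (simp add: field_simps)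
  moreover have "ei (- (z + 1)\<^sup>2 / t) = ei (- z\<^sup>2 / t) * ei (- 1 / t - 2 * (z / t))"
    unfolding ei_add[symmetric] using t0 by (intro arg_cong[of _ _ ei]) (simp add: field_simps power2_eq_square)
  ultimately show "ei (- (z + 1)\<^sup>2 / t) * psi ((z + 1) / t) (- 1 / t) = - (ei (- z\<^sup>2 / t) * psi (z / t) (- 1 / t))"
    by simp
  have "psi ((z + t) / t) (- 1 / t) = - psi (z / t) (- 1 / t)"
    using psi_plus_1[of "z / t"] t0 by (simp add: add_divide_distrib)
  moreover have "ei (- (z + t)\<^sup>2 / t) = ei (- t - 2 * z) * ei (- z\<^sup>2 / t)"
    unfolding ei_add[symmetric] using t0 by (intro arg_cong[of _ _ ei]) (simp add: field_simps power2_eq_square)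
  ultimately show "ei (- (z + t)\<^sup>2 / t) * psi ((z + t) / t) (- 1 / t) =
      - ei (- t - 2 * z) * (ei (- z\<^sup>2 / t) * psi (z / t) (- 1 / t))"
    by simp
  have "psi 0 (- 1 / t) = 0" using psi_eq_0_iff[OF t', of 0] by (metis add_0 mult_zero_left of_int_0)
  thus "ei (- 0\<^sup>2 / t) * psi (0 / t) (- 1 / t) = 0" by simp
qed (use psi_eq_0_iff[OF t] deriv_psi_nonzero[OF t] in auto)

text \<open>Up to sign, the classical Siegel function without its factor ei(t/6), the twelfth root
  of the nome ei(2t).\<close>

definition siegel :: "real \<Rightarrow> real \<Rightarrow> complex \<Rightarrow> complex" where
  "siegel x y t = ei (of_real x * (of_real x * t + of_real y)) * psi (of_real x * t + of_real y) t"

lemma siegel_translate: "siegel x y (t + 1) = siegel x (x + y) t"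
proof -
  have "ei 2 = 1" using ei_eq_1_iff[of 2] by (auto intro: exI[of _ 1])
  hence "psi z (t + 1) = psi z t" for z by (simp add: psi_def ring_distribs ei_add ei_diff)
  thus ?thesis by (simp add: siegel_def algebra_simps)
qed

lemma siegel_minus: "Im t > 0 \<Longrightarrow> siegel (- x) (- y) t = - siegel x y t"
  using psi_minus[of t "of_real x * t + of_real y"] by (simp add: siegel_def algebra_simps)

lemma siegel_plus_int_right: "siegel x (y + of_int m) t = ei (of_int m * (1 + of_real x)) * siegel x y t"
proof -
  have 1: "siegel x (y + 1) t = ei (1 + of_real x) * siegel x y t" for y
    using psi_plus_1[of "of_real x * t + of_real y" t]
    by (simp add: siegel_def ei_add ring_distribs add_ac)
  show ?thesis
  proof (induction m rule: int_induct[where k = 0])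
    case (step1 i)
    thus ?case using 1[of "y + of_int i"] by (simp add: algebra_simps ei_add)
  next
    case (step2 i)
    thus ?case using 1[of "y + of_int (i - 1)"] by (simp add: algebra_simps ei_add ei_diff field_simps)
  qed simp
qed

lemma siegel_plus_int_left:
  assumes "Im t > 0"
  shows "siegel (x + of_int m) y t = ei (of_int m * (1 - of_real y)) * siegel x y t"
proof -
  have 1: "siegel (x + 1) y t = ei (1 - of_real y) * siegel x y t" for x
  proof -
    define z where "z = of_real x * t + of_real y"
    have "siegel (x + 1) y t = ei (of_real (x + 1) * (z + t)) * (ei 1 * ei (- t - 2 * z) * psi z t)"
      using psi_plus_period[OF assms, of z] by (simp add: siegel_def z_def algebra_simps)
    also have "\<dots> = ei (1 - of_real y) * (ei (of_real x * z) * psi z t)"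
      unfolding mult.assoc[symmetric] ei_add[symmetric] z_def by (simp add: algebra_simps)
    finally show ?thesis by (simp add: siegel_def z_def)
  qed
  show ?thesis
  proof (induction m rule: int_induct[where k = 0])
    case (step1 i)
    thus ?case using 1[of "x + of_int i"] by (simp add: algebra_simps ei_add ei_diff)
  next
    case (step2 i)
    have "ei (1 - of_real y) * siegel (x + of_int (i - 1)) y t = ei (of_int i * (1 - of_real y)) * siegel x y t"
      using 1[of "x + of_int (i - 1)"] step2 by simp
    also have "ei (of_int i * (1 - of_real y)) = ei (1 - of_real y) * ei (of_int (i - 1) * (1 - of_real y))"
      unfolding ei_add[symmetric] by (simp add: algebra_simps)
    finally show ?case by (simp only: mult.assoc mult_cancel_left ei_nonzero simp_thms)
  qed simp
qed

lemma siegel_eq_0_iff: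
  assumes "Im t > 0"
  shows "siegel x y t = 0 \<longleftrightarrow> x \<in> \<int> \<and> y \<in> \<int>"
proof -
  have "of_real x * t + of_real y = of_int m + of_int n * t \<longleftrightarrow> x = of_int n \<and> y = of_int m" for m n :: int
    using assms by (auto simp: complex_eq_iff)
  thus ?thesis unfolding siegel_def using psi_eq_0_iff[OF assms]
    by (auto simp: Ints_def)
qed

lemma holomorphic_on_siegel [holomorphic_intros]:
  "siegel x y holomorphic_on {t. Im t > 0}"
  unfolding siegel_def[abs_def] by (intro holomorphic_intros open_halfspace_Im_gt) auto

text \<open>The inversion permutes the three points of order two up to roots of unity, so this
  product pins down its multiplier. Euler's identity collapses the infinite products, and the fourth
  power turns the constants into -16.\<close>

lemma siegel_two_torsion:
  assumes t: "Im t > 0"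
  shows "(siegel (1/2) 0 t * siegel 0 (1/2) t * siegel (1/2) (1/2) t) ^ 4 = - 16 * ei (- 2 * t)"
proof -
  define p where "p = ei t"
  have p: "norm p < 1" "norm (p\<^sup>2) < 1" 
    using t by (auto simp: p_def norm_ei norm_power power_less_one_iff)
  have e2: "ei (2 * t) = p\<^sup>2" by (simp add: p_def ei_power)
  have ph: "ei (1 / 2) = \<i>" by (simp add: ei_def complex_eq_iff Re_exp Im_exp)
  have 1: "siegel (1/2) 0 t = ei (- t / 4) * qpoch p (p\<^sup>2) ^ 2"
  proof -
    have "siegel (1/2) 0 t = (ei (t / 4) * ei (- (t / 2))) * qpoch p (p\<^sup>2) ^ 2"
      by (simp add: siegel_def psi_def e2 p_def power2_eq_square)
    also have "ei (t / 4) * ei (- (t / 2)) = ei (- t / 4)" unfolding ei_add[symmetric] by simp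
    finally show ?thesis .
  qed
  have 2: "siegel 0 (1/2) t = - 2 * \<i> * qpoch (- (p\<^sup>2)) (p\<^sup>2) ^ 2"
    by (simp add: siegel_def psi_alt[OF t] ei_add ei_diff e2 ei_minus ph power2_eq_square)
  have 3: "siegel (1/2) (1/2) t = ei (- t / 4) * ei (- 1 / 4) * qpoch (- p) (p\<^sup>2) ^ 2"
  proof -
    have "ei ((t / 2 + 1 / 2) / 2) = ei (t / 4) * ei (1 / 4)"
      unfolding ei_add[symmetric] by (intro arg_cong[of _ _ ei]) (simp add: field_simps)
    hence "siegel (1/2) (1/2) t = (ei ((t / 2 + 1 / 2) / 2) * ei (- (t / 2 + 1 / 2))) * qpoch (- p) (p\<^sup>2) ^ 2"
      by (simp add: siegel_def psi_def ring_distribs ei_add ei_diff e2 p_def[symmetric] power2_eq_square)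
    also have "ei ((t / 2 + 1 / 2) / 2) * ei (- (t / 2 + 1 / 2)) = ei (- t / 4) * ei (- 1 / 4)"
      unfolding ei_add[symmetric] by (intro arg_cong[of _ _ ei]) (simp add: field_simps)
    finally show ?thesis .
  qed
  have "qpoch p (p\<^sup>2) * qpoch (- p) (p\<^sup>2) * qpoch (- (p\<^sup>2)) (p\<^sup>2) = 1"
    using qpoch_mult_minus[OF p(2), of p] qpoch_euler[OF p(2)] by simp
  hence "siegel (1/2) 0 t * siegel 0 (1/2) t * siegel (1/2) (1/2) t =
      - 2 * \<i> * ei (- t / 4) * ei (- t / 4) * ei (- 1 / 4)"
    unfolding 1 2 3 by algebra
  moreover have "ei (- t / 4) ^ 4 = ei (- t)" "ei (- 1 / 4) ^ 4 = -1"
    using ei_minus[of 1] by (simp_all add: ei_power)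
  ultimately show ?thesis
    using ei_add[of "-t" "-t"] by (simp add: power_mult_distrib)
qed

text \<open>Comparing the two-torsion products at \<open>t\<close> and at -1/t fixes the constant of
  \<open>psi_inversion\<close> up to a twelfth root of unity, which disappears from a product of
  twelve Siegel functions.\<close>

lemma siegel_inversion:
  assumes t: "Im t > 0"
  obtains c where "\<And>x y. siegel x y (- 1 / t) = c * siegel y (- x) t" "c ^ 12 = ei (2 / t + 2 * t)"
proof -
  have t0: "t \<noteq> 0" using t by auto
  have t': "Im (- 1 / t) > 0" using t by (simp add: Im_divide sum_power2_gt_zero_iff)
  obtain c where c: "\<And>z. ei (- z\<^sup>2 / t) * psi (z / t) (- 1 / t) = c * psi z t"
    using psi_inversion[OF t] by blast
  have 1: "siegel x y (- 1 / t) = c * siegel y (- x) t" for x y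
  proof -
    define z where "z = of_real y * t - of_real x"
    have z: "of_real x * (- 1 / t) + of_real y = z / t" using t0 by (simp add: z_def field_simps)
    have "ei (of_real x * (z / t)) = ei (of_real y * z) * ei (- z\<^sup>2 / t)"
      unfolding ei_add[symmetric] using t0
      by (intro arg_cong[of _ _ ei]) (simp add: z_def field_simps power2_eq_square)
    thus ?thesis using c[of z] unfolding siegel_def z by (simp add: z_def)
  qed
  have "siegel 0 (- (1/2)) t = - siegel 0 (1/2) t"
    using siegel_minus[OF t, of 0 "1/2"] by simp
  moreover have "siegel (1/2) (- (1/2)) t = ei (- 3 / 2) * siegel (1/2) (1/2) t"
    using siegel_plus_int_right[of "1/2" "1/2" "-1" t] by simp
  moreover have "ei (- 3 / 2) ^ 4 = 1"
    using ei_eq_1_iff[of "-6"] by (auto simp: ei_power intro: exI[of _ "-3"])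
  moreover have "((c * - u) * (c * v) * (c * (e * w))) ^ 4 = c ^ 12 * e ^ 4 * (v * u * w) ^ 4" for u v w e :: complex
    by algebra
  ultimately have "(siegel (1/2) 0 (- 1 / t) * siegel 0 (1/2) (- 1 / t) * siegel (1/2) (1/2) (- 1 / t)) ^ 4 =
      c ^ 12 * (siegel (1/2) 0 t * siegel 0 (1/2) t * siegel (1/2) (1/2) t) ^ 4"
    unfolding 1 by simp
  hence "ei (2 / t) = c ^ 12 * ei (- 2 * t)"
    unfolding siegel_two_torsion[OF t] siegel_two_torsion[OF t'] by simp
  hence "c ^ 12 = ei (2 / t + 2 * t)" by (simp add: ei_add ei_minus field_simps)
  with 1 that show thesis by blast
qed

section \<open>Modular functions of level one\<close>

text \<open>If \<open>f\<close> is not zero, decay at the cusp makes |f| attain its maximum over the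
  half plane, so \<open>f\<close> is constant, and decay forces the constant to be 0.\<close>

lemma modular_vanishing_at_cusp_imp_zero:
  fixes f :: "complex \<Rightarrow> complex"
  assumes hol: "f holomorphic_on {t. Im t > 0}"
    and T: "\<And>t. Im t > 0 \<Longrightarrow> f (t + 1) = f t"
    and S: "\<And>t. Im t > 0 \<Longrightarrow> f (- 1 / t) = f t"
    and cusp: "\<And>e. e > 0 \<Longrightarrow> \<exists>Y. \<forall>t. Im t > Y \<longrightarrow> norm (f t) < e"
    and t: "Im t > 0"
  shows "f t = 0"
proof (rule ccontr)
  assume ft: "f t \<noteq> 0"
  have Tm: "f (t + of_int m) = f t" if "Im t > 0" for t and m :: int
  proof (induction m rule: int_induct[where k = 0])
    case (step1 i) thus ?case using T[of "t + of_int i"] that by (simp add: add_ac)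
  next
    case (step2 i) thus ?case using T[of "t + of_int (i - 1)"] that by (simp add: add_ac)
  qed simp
  have shift: "\<exists>t'. \<bar>Re t'\<bar> \<le> 1/2 \<and> Im t' = Im t \<and> f t' = f t" if "Im t > 0" for t
  proof (intro exI[of _ "t + of_int (- round (Re t))"] conjI)
    show "f (t + of_int (- round (Re t))) = f t" by (rule Tm[OF that])
    show "\<bar>Re (t + of_int (- round (Re t)))\<bar> \<le> 1/2"
      using of_int_round_abs_le[of "Re t"] by (simp add: abs_minus_commute)
  qed simp
  \<comment> \<open>A half strip containing the usual fundamental domain is easier to reach: if |Re
    s| \<le> 1/2 and Im s < 1/2, then |s|^2 \<le> 1/2, so -1/s has at least twice the imaginary
    part. The exponent \<open>k\<close> bounds the number of doublings.\<close>
  have reduce_aux: "\<exists>t'. \<bar>Re t'\<bar> \<le> 1/2 \<and> Im t' \<ge> 1/2 \<and> f t' = f t"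
    if "Im t > 0" "Im t * 2 ^ k \<ge> 1/2" for t and k :: nat
    using that
  proof (induction k arbitrary: t)
    case 0
    thus ?case using shift[of t] by auto
  next
    case (Suc k)
    obtain s where s: "\<bar>Re s\<bar> \<le> 1/2" "Im s = Im t" "f s = f t" using shift Suc by blast
    show ?case
    proof (cases "Im s \<ge> 1/2")
      case True thus ?thesis using s by blast
    next
      case False
      have "(Re s)\<^sup>2 \<le> (1/2)\<^sup>2" "(Im s)\<^sup>2 \<le> (1/2)\<^sup>2"
        using s False Suc.prems by (auto simp: abs_le_square_iff[symmetric] intro: power_mono)
      hence le: "(Re s)\<^sup>2 + (Im s)\<^sup>2 \<le> 1/2" by (simp add: power2_eq_square)
      have pos: "(Re s)\<^sup>2 + (Im s)\<^sup>2 > 0" using s Suc.prems by (simp add: sum_power2_gt_zero_iff)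
      have "Im (- 1 / s) = Im s / ((Re s)\<^sup>2 + (Im s)\<^sup>2)" by (simp add: Im_divide)
      moreover have "Im s / ((Re s)\<^sup>2 + (Im s)\<^sup>2) \<ge> Im s / (1/2)"
        using le pos s Suc.prems by (intro divide_left_mono) auto
      ultimately have ge: "Im (- 1 / s) \<ge> 2 * Im t" using s by simp
      have "1/2 \<le> 2 * Im t * 2 ^ k" using Suc.prems by (simp add: mult_ac)
      also have "\<dots> \<le> Im (- 1 / s) * 2 ^ k" using ge by (intro mult_right_mono) auto
      finally obtain t' where "\<bar>Re t'\<bar> \<le> 1/2" "Im t' \<ge> 1/2" "f t' = f (- 1 / s)"
        using Suc.IH[of "- 1 / s"] ge Suc.prems by auto
      thus ?thesis using S[of s] s Suc.prems by metis
    qed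
  qed
  have reduce: "\<exists>t'. \<bar>Re t'\<bar> \<le> 1/2 \<and> Im t' \<ge> 1/2 \<and> f t' = f t" if "Im t > 0" for t
  proof -
    obtain k :: nat where "1 / (2 * Im t) < 2 ^ k"
      using real_arch_pow[of 2 "1 / (2 * Im t)"] by auto
    hence "Im t * 2 ^ k \<ge> 1/2" using that by (simp add: field_simps)
    thus ?thesis using reduce_aux that by blast
  qed
  \<comment> \<open>Above height \<open>Y\<close> the values are smaller than |f t|, so a maximum
    over the compact box \<open>K\<close> is a global one.\<close>
  obtain Y where Y: "\<And>s. Im s > Y \<Longrightarrow> norm (f s) < norm (f t)" using cusp[of "norm (f t)"] ft by auto
  define K where "K = cbox (Complex (-1/2) (1/2)) (Complex (1/2) (max Y (1/2)))"
  have KH: "K \<subseteq> {t. Im t > 0}" by (auto simp: K_def cbox_Complex_eq)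
  have "continuous_on K (\<lambda>s. norm (f s))"
    using holomorphic_on_imp_continuous_on[OF hol] KH continuous_on_subset
    by (intro continuous_intros) blast
  moreover have "Complex 0 (1/2) \<in> K" by (simp add: K_def in_cbox_complex_iff)
  hence "K \<noteq> {}" by blast
  moreover have "compact K" by (simp add: K_def)
  ultimately obtain s where s: "s \<in> K" "\<And>u. u \<in> K \<Longrightarrow> norm (f u) \<le> norm (f s)"
    using continuous_attains_sup[of K "\<lambda>s. norm (f s)"] by metis
  have inK: "u \<in> K" if "\<bar>Re u\<bar> \<le> 1/2" "Im u \<ge> 1/2" "Im u \<le> Y" for u
    using that by (auto simp: K_def in_cbox_complex_iff)
  have "norm (f t) \<le> norm (f s)"
  proof -
    obtain t' where t': "\<bar>Re t'\<bar> \<le> 1/2" "Im t' \<ge> 1/2" "f t' = f t" using reduce t by blast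
    moreover have "Im t' \<le> Y" using Y[of t'] t' by fastforce
    ultimately show ?thesis using s(2)[of t'] inK by simp
  qed
  have max: "norm (f u) \<le> norm (f s)" if "Im u > 0" for u
  proof -
    obtain u' where u': "\<bar>Re u'\<bar> \<le> 1/2" "Im u' \<ge> 1/2" "f u' = f u" using reduce \<open>Im u > 0\<close> by blast
    show ?thesis
    proof (cases "Im u' \<le> Y")
      case True thus ?thesis using s(2)[of u'] inK u' by simp
    next
      case False thus ?thesis using Y[of u'] u' \<open>norm (f t) \<le> norm (f s)\<close> by simp
    qed
  qed
  have "f constant_on {t. Im t > 0}"
  proof (rule maximum_modulus_principle[OF hol, where U = "{t. Im t > 0}" and \<xi> = s])
    show "connected {t. Im t > 0}" by (simp add: convex_connected convex_halfspace_Im_gt)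
  qed (use s KH max in \<open>auto simp: open_halfspace_Im_gt\<close>)
  then obtain c where c: "\<And>u. Im u > 0 \<Longrightarrow> f u = c" by (auto simp: constant_on_def)
  have "norm (f (Complex 0 (max Y 0 + 1))) < norm (f t)" by (intro Y) simp
  thus False using c[of "Complex 0 (max Y 0 + 1)"] c[of t] t by simp
qed

text \<open>If one factor is not identically zero, the product of the others vanishes on the open
  set where that factor is nonzero, hence on all of \<open>S\<close> by the identity
  theorem.\<close>

lemma holomorphic_prod_eq_0_imp_factor_eq_0:
  fixes f :: "'i \<Rightarrow> complex \<Rightarrow> complex"
  assumes I: "finite I" and S: "open S" "connected S" "S \<noteq> {}"
    and hol: "\<And>i. i \<in> I \<Longrightarrow> f i holomorphic_on S"
    and zero: "\<And>z. z \<in> S \<Longrightarrow> (\<Prod>i\<in>I. f i z) = 0"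
  shows "\<exists>i\<in>I. \<forall>z\<in>S. f i z = 0"
  using I hol zero
proof (induction I rule: finite_induct)
  case empty thus ?case using S by auto
next
  case (insert j I)
  show ?case
  proof (cases "\<forall>z\<in>S. f j z = 0")
    case False
    then obtain w where w: "w \<in> S" "f j w \<noteq> 0" by blast
    have cj: "continuous_on S (f j)" using insert holomorphic_on_imp_continuous_on by blast
    define U where "U = {z \<in> S. f j z \<noteq> 0}"
    have "U = S \<inter> f j -` (- {0})" by (auto simp: U_def)
    hence "open U" using continuous_open_preimage[OF cj S(1), of "- {0}"] by auto
    have "(\<Prod>i\<in>I. f i z) = 0" if "z \<in> S" for z
    proof (rule analytic_continuation_open[where f = "\<lambda>z. \<Prod>i\<in>I. f i z" and g = "\<lambda>_. 0" and s = U and s' = S])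
      show "(\<lambda>z. \<Prod>i\<in>I. f i z) holomorphic_on S" using insert by (intro holomorphic_intros) auto
      show "(\<Prod>i\<in>I. f i z) = 0" if "z \<in> U" for z
        using insert.prems(2)[of z] that insert.hyps by (auto simp: U_def)
    qed (use \<open>open U\<close> w S that in \<open>auto simp: U_def\<close>)
    thus ?thesis using insert by auto
  qed auto
qed

section \<open>Generating functions of partitions\<close>

abbreviation partitions_into :: "nat set \<Rightarrow> nat \<Rightarrow> nat multiset set" where
  "partitions_into S n \<equiv> {P. set_mset P \<subseteq> S \<and> sum_mset P = n}"

lemma size_le_sum_mset: "0 \<notin># P \<Longrightarrow> size P \<le> sum_mset (P :: nat multiset)"
  by (induction P) (auto simp: Suc_le_eq)

lemma finite_partitions_into:
  assumes "0 \<notin> S"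
  shows "finite (partitions_into S n)"
proof (rule finite_subset)
  show "partitions_into S n \<subseteq> mset ` {xs. set xs \<subseteq> {..n} \<and> length xs \<le> n}"
  proof
    fix P assume P: "P \<in> partitions_into S n"
    obtain xs where xs: "mset xs = P" using ex_mset by blast
    have "set xs \<subseteq> {..n}"
    proof
      fix x assume "x \<in> set xs"
      hence "x \<in># P" using xs by auto
      thus "x \<in> {..n}" using P sum_mset.remove[of x P] by auto
    qed
    moreover have "0 \<notin># P" using P assms by auto
    hence "length xs \<le> n" using size_le_sum_mset[of P] P xs by auto
    ultimately show "P \<in> mset ` {xs. set xs \<subseteq> {..n} \<and> length xs \<le> n}" using xs by blast
  qed
  show "finite (mset ` {xs. set xs \<subseteq> {..n} \<and> length xs \<le> n})"
    by (intro finite_imageI finite_lists_length_le) auto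
qed

lemma num_partitions_0: 
  assumes "0 \<notin> S"
  shows "num_partitions S 0 = 1"
proof -
  have "P = {#}" if "set_mset P \<subseteq> S" "sum_mset P = 0" for P
  proof -
    have "0 \<notin># P" using that assms by auto
    thus ?thesis using size_le_sum_mset[of P] that by auto
  qed
  hence "partitions_into S 0 = {{#}}" by auto
  thus ?thesis by (simp add: num_partitions_def)
qed

lemma num_partitions_empty: "n > 0 \<Longrightarrow> num_partitions {} n = 0"
  by (auto simp: num_partitions_def card_eq_0_iff)

lemma num_partitions_cong:
  assumes "S \<inter> {..n} = T \<inter> {..n}"
  shows "num_partitions S n = num_partitions T n"
proof -
  have "set_mset P \<subseteq> S \<longleftrightarrow> set_mset P \<subseteq> T" if "sum_mset P = n" for P
  proof -
    have "set_mset P \<subseteq> {..n}"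
    proof
      fix x assume "x \<in># P"
      thus "x \<in> {..n}" using that sum_mset.remove[of x P] by auto
    qed
    thus ?thesis using assms by blast
  qed
  hence "partitions_into S n = partitions_into T n" by blast
  thus ?thesis by (simp add: num_partitions_def)
qed

lemma num_partitions_mono:
  "A \<subseteq> S \<Longrightarrow> 0 \<notin> S \<Longrightarrow> num_partitions A n \<le> num_partitions S n"
  unfolding num_partitions_def by (intro card_mono finite_partitions_into) auto

text \<open>Removing one copy of \<open>a\<close> matches the partitions of n that use
  \<open>a\<close> with all partitions of n - a.\<close>

lemma num_partitions_insert:
  assumes "a \<notin> A" "a > 0" "0 \<notin> A"
  shows "num_partitions (insert a A) n =
    num_partitions A n + (if a \<le> n then num_partitions (insert a A) (n - a) else 0)"
proof -
  let ?X = "{P \<in> partitions_into (insert a A) n. a \<in># P}"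
  have fin: "finite (partitions_into (insert a A) n)" "finite (partitions_into A n)"
    using assms by (auto intro: finite_partitions_into)
  have "partitions_into (insert a A) n = partitions_into A n \<union> ?X"
    using assms by auto
  moreover have "partitions_into A n \<inter> ?X = {}" using assms by auto
  ultimately have 1: "num_partitions (insert a A) n = num_partitions A n + card ?X"
    unfolding num_partitions_def using fin
    by (metis (no_types, lifting) card_Un_disjoint finite_Un)
  have 2: "card ?X = num_partitions (insert a A) (n - a)" if "a \<le> n"
    unfolding num_partitions_def
  proof (rule bij_betw_same_card[of "\<lambda>P. P - {#a#}"], rule bij_betwI[where g = "\<lambda>P. add_mset a P"])
    show "(\<lambda>P. P - {#a#}) \<in> ?X \<rightarrow> partitions_into (insert a A) (n - a)"
      by (auto dest: in_diffD simp: sum_mset_diff)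
  qed (use that in auto)
  have 3: "card ?X = 0" if "\<not> a \<le> n"
  proof -
    have "a \<le> sum_mset P" if "a \<in># P" for P using sum_mset.remove[OF that] by simp
    hence "?X = {}" using that by auto
    thus ?thesis by (simp only: card.empty)
  qed
  show ?thesis using 1 2 3 by auto
qed

text \<open>Here \<open>k\<close> is the total of the parts equal to \<open>a\<close>. This is
  multiplication by the geometric series of q^a, in the shape of a Cauchy product.\<close>

lemma num_partitions_insert_conv_sum:
  assumes "a \<notin> A" "a > 0" "0 \<notin> A"
  shows "num_partitions (insert a A) n = (\<Sum>k\<le>n. if a dvd k then num_partitions A (n - k) else 0)"
proof (induction n rule: less_induct)
  case (less n)
  have small: "(\<Sum>k\<in>B. if a dvd k then num_partitions A (n - k) else 0) = num_partitions A n"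
    if "B \<subseteq> {..<a}" "0 \<in> B" "finite B" for B
  proof -
    have "(\<Sum>k\<in>B. if a dvd k then num_partitions A (n - k) else 0) =
          (\<Sum>k\<in>{0}. if a dvd k then num_partitions A (n - k) else 0)"
    proof (intro sum.mono_neutral_right ballI)
      fix i assume "i \<in> B - {0}"
      hence "\<not> a dvd i" using that by (intro nat_dvd_not_less) auto
      thus "(if a dvd i then num_partitions A (n - i) else 0) = 0" by simp
    qed (use that in auto)
    thus ?thesis by simp
  qed
  show ?case
  proof (cases "a \<le> n")
    case False
    hence "{..n} \<subseteq> {..<a}" by auto
    from small[OF this] show ?thesis using False num_partitions_insert[OF assms, of n] by simp
  next
    case True
    have "(\<Sum>k\<in>{a..n}. if a dvd k then num_partitions A (n - k) else 0) =
          (\<Sum>k\<le>n - a. if a dvd k then num_partitions A (n - a - k) else 0)"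
      by (rule sum.reindex_bij_witness[of _ "\<lambda>k. k + a" "\<lambda>k. k - a"])
         (use True in \<open>auto simp: dvd_minus_self\<close>)
    moreover have "{..n} = {..<a} \<union> {a..n}" using True by auto
    hence "(\<Sum>k\<le>n. if a dvd k then num_partitions A (n - k) else 0) =
      (\<Sum>k\<in>{..<a}. if a dvd k then num_partitions A (n - k) else 0) +
      (\<Sum>k\<in>{a..n}. if a dvd k then num_partitions A (n - k) else 0)"
      by (simp add: sum.union_disjoint ivl_disj_int)
    moreover have "num_partitions (insert a A) n = num_partitions A n + num_partitions (insert a A) (n - a)"
      using num_partitions_insert[OF assms, of n] True by simp
    moreover have "num_partitions (insert a A) (n - a) =
        (\<Sum>k\<le>n - a. if a dvd k then num_partitions A (n - a - k) else 0)"
      using less[of "n - a"] True assms by simp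
    moreover have "(\<Sum>k<a. if a dvd k then num_partitions A (n - k) else 0) = num_partitions A n"
      using small[of "{..<a}"] assms by blast
    ultimately show ?thesis by linarith
  qed
qed

lemma sums_num_partitions_finite:
  fixes q :: complex
  assumes "finite A" "0 \<notin> A" "norm q < 1"
  shows "(\<lambda>n. of_nat (num_partitions A n) * q ^ n) sums (1 / (\<Prod>a\<in>A. 1 - q ^ a))"
  using assms
proof (induction A arbitrary: q rule: finite_induct)
  case empty
  have "(\<lambda>n. of_nat (num_partitions {} n) * q ^ n) sums (of_nat (num_partitions {} 0) * q ^ 0)"
    by (rule sums_single[THEN sums_cong[THEN iffD1, rotated]]) (auto simp: num_partitions_empty)
  thus ?case by (simp add: num_partitions_0)
next
  case (insert a A)
  hence a: "a > 0" "0 \<notin> A" by auto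
  let ?g = "\<lambda>q k. if a dvd k then q ^ k else (0::complex)"
  have g: "?g q sums (1 / (1 - q ^ a))" if "norm q < 1" for q
  proof -
    have "norm (q ^ a) < 1" using that a by (simp add: norm_power power_less_one_iff)
    hence "(\<lambda>k. (q ^ a) ^ k) sums (1 / (1 - q ^ a))" by (rule geometric_sums)
    hence "(\<lambda>k. ?g q (a * k)) sums (1 / (1 - q ^ a))" by (simp add: power_mult)
    thus ?thesis using a
      by (subst (asm) sums_mono_reindex) (auto simp: strict_mono_def elim!: dvdE)
  qed
  have r: "norm (complex_of_real (norm q)) < 1" using insert by simp
  have sg: "summable (\<lambda>k. norm (?g q k))"
  proof -
    have "summable (\<lambda>k. complex_of_real (norm (?g q k)))"
    proof -
      have "(\<lambda>k. complex_of_real (norm (?g q k))) = ?g (of_real (norm q))"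
        by (auto simp: norm_power)
      thus ?thesis using g[OF r] sums_summable by auto
    qed
    thus ?thesis by (simp only: summable_complex_of_real)
  qed
  \<comment> \<open>Absolute convergence at \<open>q\<close> is convergence at the real point
    \<open>norm q\<close>, because the coefficients are nonnegative; hence the induction is over all
    \<open>q\<close>.\<close>
  have sp: "summable (\<lambda>k. norm (of_nat (num_partitions A k) * q ^ k))"
  proof -
    have "(\<lambda>k. complex_of_real (norm (of_nat (num_partitions A k) * q ^ k))) =
       (\<lambda>k. of_nat (num_partitions A k) * of_real (norm q) ^ k)"
      by (simp add: norm_mult norm_power)
    hence "summable (\<lambda>k. complex_of_real (norm (of_nat (num_partitions A k) * q ^ k)))"
      using sums_summable[OF insert.IH[OF a(2) r]] by (simp only:)
    thus ?thesis by (simp only: summable_complex_of_real)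
  qed
  have "(\<lambda>k. \<Sum>i\<le>k. ?g q i * (of_nat (num_partitions A (k - i)) * q ^ (k - i))) sums
      ((\<Sum>k. ?g q k) * (\<Sum>k. of_nat (num_partitions A k) * q ^ k))"
    by (rule Cauchy_product_sums[OF sg sp])
  moreover have "(\<Sum>i\<le>k. ?g q i * (of_nat (num_partitions A (k - i)) * q ^ (k - i))) =
     of_nat (num_partitions (insert a A) k) * q ^ k" for k
    unfolding num_partitions_insert_conv_sum[OF insert.hyps(2) a] of_nat_sum sum_distrib_right
    by (intro sum.cong) (auto simp flip: power_add)
  ultimately show ?case
    using sums_unique[OF g, of q, symmetric] sums_unique[OF insert.IH[OF a(2)], of q, symmetric] insert
    by simp
qed

text \<open>The truncations of \<open>S\<close> have eventually constant coefficients, and Tannery's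
  theorem exchanges limit and sum. The dominating series comes from the point \<open>norm q\<close>:
  there the reciprocals of the finite products are bounded and bound all partial sums. For this the
  limit is assumed on the whole disc.\<close>

lemma sums_num_partitions:
  fixes q :: complex and g :: "nat \<Rightarrow> nat"
  assumes S: "0 \<notin> S" and g: "filterlim g at_top at_top" and q: "norm q < 1"
    and lim: "\<And>q. norm q < 1 \<Longrightarrow> (\<lambda>m. \<Prod>a\<in>S \<inter> {..g m}. 1 - q ^ a) \<longlonglongrightarrow> L q"
    and L: "\<And>q. norm q < 1 \<Longrightarrow> L q \<noteq> 0"
  shows "(\<lambda>n. of_nat (num_partitions S n) * q ^ n) sums (1 / L q)"
proof -
  define x where "x = norm q"
  have x: "norm (complex_of_real x) < 1" "x \<ge> 0" using q by (auto simp: x_def)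
  define A where "A m = S \<inter> {..g m}" for m
  have A: "finite (A m)" "0 \<notin> A m" for m using S by (auto simp: A_def)
  have PA: "num_partitions (A m) n = num_partitions S n" if "n \<le> g m" for m n
    using that by (intro num_partitions_cong) (auto simp: A_def)
  have Ale: "num_partitions (A m) n \<le> num_partitions S n" for m n
    using S by (intro num_partitions_mono) (auto simp: A_def)
  have fin: "(\<lambda>n. of_nat (num_partitions (A m) n) * q ^ n) sums (1 / (\<Prod>a\<in>A m. 1 - q ^ a))"
    if "norm q < 1" for m and q :: complex
    using sums_num_partitions_finite A that by blast
  have R: "(\<lambda>m. 1 / (\<Prod>a\<in>A m. 1 - q ^ a)) \<longlonglongrightarrow> 1 / L q" if "norm q < 1" for q
    unfolding A_def by (intro tendsto_intros lim L that)
  have "Bseq (\<lambda>m. 1 / (\<Prod>a\<in>A m. 1 - of_real x ^ a :: complex))"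
    using R[OF x(1)] by (intro convergent_imp_Bseq convergentI)
  then obtain B where B: "\<And>m. norm (1 / (\<Prod>a\<in>A m. 1 - of_real x ^ a :: complex)) \<le> B"
    by (auto simp: Bseq_def)
  have sm: "summable (\<lambda>n. real (num_partitions S n) * norm q ^ n)"
  proof (rule bounded_imp_summable)
    show "(\<Sum>n\<le>N. real (num_partitions S n) * norm q ^ n) \<le> B" for N
    proof -
      have "eventually (\<lambda>m. g m \<ge> N) sequentially" using g by (simp add: filterlim_at_top)
      then obtain m where m: "g m \<ge> N" by (auto simp: eventually_sequentially)
      have s: "(\<lambda>n. complex_of_real (real (num_partitions (A m) n) * x ^ n)) sums (1 / (\<Prod>a\<in>A m. 1 - of_real x ^ a))"
        using fin[OF x(1), of m] by simp
      hence sr: "summable (\<lambda>n. real (num_partitions (A m) n) * x ^ n)"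
        using sums_summable[OF s] by (simp only: summable_complex_of_real)
      have "(\<Sum>n\<le>N. real (num_partitions S n) * norm q ^ n) = (\<Sum>n\<le>N. real (num_partitions (A m) n) * x ^ n)"
        using m PA by (intro sum.cong) (auto simp: x_def)
      also have "\<dots> \<le> (\<Sum>n. real (num_partitions (A m) n) * x ^ n)"
        using x by (intro sum_le_suminf sr) auto
      also have "complex_of_real \<dots> = 1 / (\<Prod>a\<in>A m. 1 - of_real x ^ a)"
        using sums_unique2[OF sums_of_real[OF summable_sums[OF sr], where 'a = complex] s] .
      hence "(\<Sum>n. real (num_partitions (A m) n) * x ^ n) \<le> norm (1 / (\<Prod>a\<in>A m. 1 - of_real x ^ a :: complex))"
        by (metis abs_ge_self norm_of_real)
      also have "\<dots> \<le> B" by (rule B)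
      finally show ?thesis .
    qed
  qed auto
  have t: "(\<lambda>m. \<Sum>n. of_nat (num_partitions (A m) n) * q ^ n) \<longlonglongrightarrow> (\<Sum>n. of_nat (num_partitions S n) * q ^ n)"
    and s: "summable (\<lambda>n. norm (of_nat (num_partitions S n) * q ^ n))"
  proof -
    have "eventually (\<lambda>m. of_nat (num_partitions (A m) n) * q ^ n = of_nat (num_partitions S n) * q ^ n) sequentially" for n
      using filterlim_at_top[THEN iffD1, OF g, rule_format, of n] by eventually_elim (simp add: PA)
    hence 1: "(\<lambda>m. of_nat (num_partitions (A m) n) * q ^ n) \<longlonglongrightarrow> of_nat (num_partitions S n) * q ^ n" for n
      by (rule tendsto_eventually)
    have "norm (of_nat (num_partitions (A m) n) * q ^ n) \<le> real (num_partitions S n) * norm q ^ n" for m n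
      using Ale[of m n] by (simp add: norm_mult norm_power mult_right_mono)
    hence 2: "eventually (\<lambda>(n, m). norm (of_nat (num_partitions (A m) n) * q ^ n) \<le>
        real (num_partitions S n) * norm q ^ n) (at_top \<times>\<^sub>F sequentially)"
      by (intro always_eventually) auto
    show "(\<lambda>m. \<Sum>n. of_nat (num_partitions (A m) n) * q ^ n) \<longlonglongrightarrow> (\<Sum>n. of_nat (num_partitions S n) * q ^ n)"
      using tannerys_theorem[OF 1 2 sm] by simp
    show "summable (\<lambda>n. norm (of_nat (num_partitions S n) * q ^ n))"
      using tannerys_theorem[OF 1 2 sm] by simp
  qed
  have "(\<Sum>n. of_nat (num_partitions (A m) n) * q ^ n) = 1 / (\<Prod>a\<in>A m. 1 - q ^ a)" for m
    using sums_unique[OF fin[OF q]] by simp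
  hence "(\<Sum>n. of_nat (num_partitions S n) * q ^ n) = 1 / L q"
    using LIMSEQ_unique[OF _ R[OF q]] t by simp
  thus "(\<lambda>n. of_nat (num_partitions S n) * q ^ n) sums (1 / L q)"
    using summable_sums[OF summable_norm_cancel[OF s]] by simp
qed

text \<open>The number \<open>60 - a mod 60\<close> represents the class of -a. It equals 60,
  outside \<open>R\<close>, when 60 divides \<open>a\<close>.\<close>

lemma pm_residues_60_iff:
  assumes "R \<subseteq> {1..29}"
  shows "a \<in> pm_residues (int ` R) 60 \<longleftrightarrow> a > 0 \<and> (a mod 60 \<in> R \<or> 60 - a mod 60 \<in> R)"
proof -
  have "[int a = int r] (mod 60) \<longleftrightarrow> a mod 60 = r" "[int a = - int r] (mod 60) \<longleftrightarrow> 60 - a mod 60 = r"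
    if "r \<in> R" for r
  proof -
    have r: "1 \<le> r" "r \<le> 29" using that assms by auto
    have "int a mod 60 = int (a mod 60)" by (simp add: zmod_int)
    moreover have "int r mod 60 = int r" "(- int r) mod 60 = int (60 - r)"
      using r by (simp_all add: zmod_zminus1_eq_if)
    moreover have "a mod 60 = 60 - r \<longleftrightarrow> 60 - a mod 60 = r"
      using r mod_less_divisor[of 60 a] by linarith
    ultimately have "([int a = int r] (mod 60) \<longleftrightarrow> a mod 60 = r) \<and>
        ([int a = - int r] (mod 60) \<longleftrightarrow> 60 - a mod 60 = r)"
      unfolding unique_euclidean_semiring_class.cong_def by (simp only: of_nat_eq_iff)
    thus "[int a = int r] (mod 60) \<longleftrightarrow> a mod 60 = r"
        "[int a = - int r] (mod 60) \<longleftrightarrow> 60 - a mod 60 = r" by blast+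
  qed
  thus ?thesis by (auto simp: pm_residues_def)
qed

definition residue_product :: "nat set \<Rightarrow> complex \<Rightarrow> complex" where
  "residue_product R q = (\<Prod>r\<in>R. qpoch (q ^ r) (q ^ 60) * qpoch (q ^ (60 - r)) (q ^ 60))"

text \<open>Each new block 60m < a \<le> 60(m + 1) contributes 60m + r and 60m + (60 - r) for r in
  \<open>R\<close>; the range 1..29 makes all of these distinct.\<close>

lemma prod_pm_residues_60:
  fixes q :: complex
  assumes R: "R \<subseteq> {1..29}"
  shows "(\<Prod>a\<in>pm_residues (int ` R) 60 \<inter> {..60 * m}. 1 - q ^ a) =
    (\<Prod>r\<in>R. (\<Prod>n<m. 1 - q ^ r * (q ^ 60) ^ n) * (\<Prod>n<m. 1 - q ^ (60 - r) * (q ^ 60) ^ n))"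
proof (induction m)
  case 0
  have "pm_residues (int ` R) 60 \<inter> {..0} = {}" by (auto simp: pm_residues_def)
  thus ?case by simp
next
  case (Suc m)
  have finR: "finite R" using R finite_subset by blast
  let ?S = "pm_residues (int ` R) 60"
  let ?B = "(\<lambda>r. 60 * m + r) ` R" and ?C = "(\<lambda>r. 60 * m + (60 - r)) ` R"
  have "?S \<inter> {..60 * Suc m} = (?S \<inter> {..60 * m}) \<union> (?B \<union> ?C)"
  proof (intro set_eqI iffI)
    fix a assume a: "a \<in> ?S \<inter> {..60 * Suc m}"
    show "a \<in> (?S \<inter> {..60 * m}) \<union> (?B \<union> ?C)"
    proof (cases "a \<le> 60 * m")
      case False
      define b where "b = a - 60 * m"
      have b: "a = 60 * m + b" "0 < b" "b \<le> 60" using a False by (auto simp: b_def)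
      have "a mod 60 = b mod 60" by (simp add: b(1))
      hence "b mod 60 \<in> R \<or> 60 - b mod 60 \<in> R" using a pm_residues_60_iff[OF R, of a] by simp
      moreover have "b \<noteq> 60" using calculation R by (auto simp: subset_iff)
      ultimately have "b \<in> R \<or> 60 - b \<in> R" using b by simp
      moreover have "a = 60 * m + (60 - (60 - b))" using b by simp
      ultimately show ?thesis using b(1) by blast
    qed (use a in auto)
  next
    fix a assume a: "a \<in> (?S \<inter> {..60 * m}) \<union> (?B \<union> ?C)"
    have "60 * m + r \<in> ?S \<inter> {..60 * Suc m}" "60 * m + (60 - r) \<in> ?S \<inter> {..60 * Suc m}" if "r \<in> R" for r
    proof -
      have r: "1 \<le> r" "r \<le> 29" using that R by auto
      have "(60 * m + k) mod 60 = k" if "k < 60" for k using that by simp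
      from this[of r] this[of "60 - r"]
      have m: "(60 * m + r) mod 60 = r" "(60 * m + (60 - r)) mod 60 = 60 - r" using r by linarith+
      show "60 * m + r \<in> ?S \<inter> {..60 * Suc m}"
        using pm_residues_60_iff[OF R, of "60 * m + r"] m r that by auto
      show "60 * m + (60 - r) \<in> ?S \<inter> {..60 * Suc m}"
        using pm_residues_60_iff[OF R, of "60 * m + (60 - r)"] m r that by auto
    qed
    thus "a \<in> ?S \<inter> {..60 * Suc m}" using a by auto
  qed
  moreover have lt: "1 \<le> r \<and> r \<le> 29" if "r \<in> R" for r using that R by auto
  have "?B \<inter> ?C = {}"
  proof (rule equals0I)
    fix a assume "a \<in> ?B \<inter> ?C"
    then obtain r s where "r \<in> R" "s \<in> R" "60 * m + r = 60 * m + (60 - s)" by blast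
    thus False using lt[of r] lt[of s] by linarith
  qed
  moreover have "?S \<inter> {..60 * m} \<inter> (?B \<union> ?C) = {}"
  proof (rule equals0I)
    fix a assume "a \<in> ?S \<inter> {..60 * m} \<inter> (?B \<union> ?C)"
    then obtain r where "r \<in> R" "a \<le> 60 * m" "a = 60 * m + r \<or> a = 60 * m + (60 - r)" by blast
    thus False using lt[of r] by linarith
  qed
  moreover have "finite ?B" "finite ?C" using finR by blast+
  moreover have e: "q ^ (60 * m + k) = q ^ k * (q ^ 60) ^ m" for k
    by (simp only: power_add power_mult mult.commute[of "q ^ k"])
  ultimately have "(\<Prod>a\<in>?S \<inter> {..60 * Suc m}. 1 - q ^ a) =
     (\<Prod>a\<in>?S \<inter> {..60 * m}. 1 - q ^ a) * ((\<Prod>a\<in>?B. 1 - q ^ a) * (\<Prod>a\<in>?C. 1 - q ^ a))"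
    by (simp add: prod.union_disjoint)
  also have "(\<Prod>a\<in>?B. 1 - q ^ a) = (\<Prod>r\<in>R. 1 - q ^ r * (q ^ 60) ^ m)"
    by (rule prod.reindex_cong[of "\<lambda>r. 60 * m + r"]) (simp_all only: e inj_on_add)
  also have "(\<Prod>a\<in>?C. 1 - q ^ a) = (\<Prod>r\<in>R. 1 - q ^ (60 - r) * (q ^ 60) ^ m)"
  proof (rule prod.reindex_cong[of "\<lambda>r. 60 * m + (60 - r)"])
    show "inj_on (\<lambda>r. 60 * m + (60 - r)) R"
    proof (rule inj_onI)
      fix r s assume "r \<in> R" "s \<in> R" "60 * m + (60 - r) = 60 * m + (60 - s)"
      thus "r = s" using lt[of r] lt[of s] by linarith
    qed
  qed (simp_all only: e)
  finally show ?case unfolding Suc by (simp add: prod.distrib mult_ac)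
qed

lemma residue_product_nonzero:
  assumes "R \<subseteq> {1..29}" "norm q < 1"
  shows "residue_product R q \<noteq> 0"
proof -
  have "finite R" using assms finite_subset by blast
  have q: "norm (q ^ 60) < 1" using assms by (simp add: norm_power power_less_one_iff)
  have "qpoch (q ^ k) (q ^ 60) \<noteq> 0" if "k > 0" for k
  proof -
    have "norm (q ^ k * (q ^ 60) ^ n) < 1" for n
      using assms that by (simp add: power_less_one_iff norm_power flip: power_mult power_add)
    thus ?thesis unfolding qpoch_eq_0_iff[OF q] by (metis norm_one less_irrefl)
  qed
  moreover have "0 < r \<and> 0 < 60 - r" if "r \<in> R" for r using that assms by force
  ultimately show ?thesis unfolding residue_product_def using \<open>finite R\<close>
    by simp
qed

lemma sums_num_partitions_pm_residues:
  fixes q :: complex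
  assumes R: "R \<subseteq> {1..29}" and q: "norm q < 1"
  defines "S \<equiv> pm_residues (int ` R) 60"
  shows "(\<lambda>n. of_nat (num_partitions S n) * q ^ n) sums (1 / residue_product R q)"
proof -
  have S: "0 \<notin> S" by (simp add: S_def pm_residues_def)
  have g: "filterlim (\<lambda>m::nat. 60 * m) at_top at_top"
    by (rule filterlim_subseq) (auto simp: strict_mono_def)
  have lim: "(\<lambda>m. \<Prod>a\<in>S \<inter> {..60 * m}. 1 - q ^ a) \<longlonglongrightarrow> residue_product R q" if "norm q < 1" for q
    unfolding S_def prod_pm_residues_60[OF R] residue_product_def using that
    by (intro tendsto_intros qpoch_LIMSEQ) (auto simp: norm_power power_less_one_iff)
  show "(\<lambda>n. of_nat (num_partitions S n) * q ^ n) sums (1 / residue_product R q)"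
    by (rule sums_num_partitions[OF S g q lim]) (use residue_product_nonzero[OF R] in auto)
qed

section \<open>Quotients of Siegel functions\<close>

lemma ei_sum: "ei (\<Sum>i\<in>I. f i) = (\<Prod>i\<in>I. ei (f i))"
  by (simp add: ei_def sum_distrib_left exp_sum) (cases "finite I"; simp add: exp_sum)

text \<open>Shifting x by integers changes only the phase, so x may be replaced by its fractional
  part f. Then the prefactor has norm exp(pi f (1 - f) Im t), and both infinite products are bounded
  below for Im t \<ge> 1.\<close>

lemma siegel_lower_bound:
  assumes xy: "x \<notin> \<int> \<or> y \<notin> \<int>"
  shows "\<exists>C\<ge>0. \<forall>t. Im t \<ge> 1 \<longrightarrow> norm (1 / siegel x y t) \<le> C * exp (- pi * frac x * (1 - frac x) * Im t)"
proof -
  define f where "f = frac x"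
  have f: "0 \<le> f" "f < 1" by (auto simp: f_def frac_lt_1)
  have x: "x = f + of_int \<lfloor>x\<rfloor>" by (simp add: f_def frac_def)
  define z where "z t = complex_of_real f * t + of_real y" for t
  define \<rho> where "\<rho> = exp (- 2 * pi)"
  have \<rho>: "0 < \<rho>" "\<rho> < 1" by (auto simp: \<rho>_def)
  have norm_siegel: "norm (siegel x y t) = exp (pi * f * (1 - f) * Im t) *
      norm (qpoch (ei (2 * z t)) (ei (2 * t))) * norm (qpoch (ei (2 * t - 2 * z t)) (ei (2 * t)))"
    if t: "Im t \<ge> 1" for t
  proof -
    have "norm (siegel x y t) = norm (siegel f y t)"
      using siegel_plus_int_left[of t f "\<lfloor>x\<rfloor>" y] x t by (simp add: norm_mult norm_ei)
    also have "\<dots> = exp (- pi * (f * f * Im t)) * exp (pi * (f * Im t)) *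
      norm (qpoch (ei (2 * z t)) (ei (2 * t))) * norm (qpoch (ei (2 * t - 2 * z t)) (ei (2 * t)))"
      by (simp add: siegel_def psi_def norm_mult norm_ei z_def)
    also have "exp (- pi * (f * f * Im t)) * exp (pi * (f * Im t)) = exp (pi * f * (1 - f) * Im t)"
      unfolding exp_add[symmetric] by (simp add: algebra_simps)
    finally show ?thesis .
  qed
  have q: "norm (ei (2 * t)) \<le> \<rho>" if "Im t \<ge> 1" for t
    using that by (simp add: norm_ei \<rho>_def)
  have second: "norm (qpoch (of_real (exp (- 2 * pi * (1 - f)))) (of_real \<rho>)) \<le>
      norm (qpoch (ei (2 * t - 2 * z t)) (ei (2 * t)))" if "Im t \<ge> 1" for t
  proof (rule qpoch_norm_le)
    have "2 * pi * (1 - f) * 1 \<le> 2 * pi * (1 - f) * Im t" using f that by (intro mult_left_mono) auto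
    moreover have "- pi * Im (2 * t - 2 * z t) = - (2 * pi * (1 - f) * Im t)"
      by (simp add: z_def algebra_simps)
    ultimately show "norm (ei (2 * t - 2 * z t)) \<le> exp (- 2 * pi * (1 - f))"
      unfolding norm_ei by simp
    show "exp (- 2 * pi * (1 - f)) < 1" using f by simp
  qed (use q that \<rho> in auto)
  have nz: "qpoch (of_real \<alpha>) (of_real \<rho>) \<noteq> 0" if "0 \<le> \<alpha>" "\<alpha> < 1" for \<alpha>
  proof -
    have "\<alpha> * \<rho> ^ n \<le> \<alpha> * 1" for n using \<rho> that by (intro mult_left_mono power_le_one) auto
    hence "complex_of_real (\<alpha> * \<rho> ^ n) \<noteq> 1" for n using that by (metis less_le_trans not_less of_real_eq_1_iff mult.right_neutral)
    thus ?thesis using \<rho> by (subst qpoch_eq_0_iff) auto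
  qed
  \<comment> \<open>For f = 0 the product starts with 1 - ei(2y), which does not approach 1 at the
    cusp; it is split off, and \<open>y\<close> not being an integer keeps it nonzero.\<close>
  have first: "\<exists>\<delta>>0. \<forall>t. Im t \<ge> 1 \<longrightarrow> \<delta> \<le> norm (qpoch (ei (2 * z t)) (ei (2 * t)))"
  proof (cases "f = 0")
    case False
    show ?thesis
    proof (intro exI[of _ "norm (qpoch (of_real (exp (- 2 * pi * f))) (of_real \<rho>))"] conjI allI impI)
      show "0 < norm (qpoch (of_real (exp (- 2 * pi * f))) (of_real \<rho>))"
        using nz[of "exp (- 2 * pi * f)"] f False by simp
      fix t :: complex assume t: "Im t \<ge> 1"
      show "norm (qpoch (of_real (exp (- 2 * pi * f))) (of_real \<rho>)) \<le> norm (qpoch (ei (2 * z t)) (ei (2 * t)))"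
      proof (rule qpoch_norm_le)
        have "f * 1 \<le> f * Im t" using f t by (intro mult_left_mono) auto
        thus "norm (ei (2 * z t)) \<le> exp (- 2 * pi * f)" by (simp add: norm_ei z_def)
        show "exp (- 2 * pi * f) < 1" using f False by simp
      qed (use q t \<rho> in auto)
    qed
  next
    case True
    hence "x \<in> \<int>" by (simp add: f_def)
    hence y: "y \<notin> \<int>" using xy by blast
    have z: "z t = of_real y" for t using True by (simp add: z_def)
    have "ei (2 * of_real y) \<noteq> 1"
    proof
      assume "ei (2 * of_real y) = 1"
      then obtain k :: int where "complex_of_real y = of_int k" unfolding ei_eq_1_iff by auto
      hence "y = of_int k" by (metis of_real_eq_iff of_real_of_int_eq)
      thus False using y by simp
    qed
    show ?thesis
    proof (intro exI[of _ "norm (1 - ei (2 * of_real y)) * norm (qpoch (of_real \<rho>) (of_real \<rho>))"] conjI allI impI)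
      show "0 < norm (1 - ei (2 * of_real y)) * norm (qpoch (of_real \<rho>) (of_real \<rho>))"
        using nz[of \<rho>] \<rho> \<open>ei (2 * of_real y) \<noteq> 1\<close> by simp
      fix t :: complex assume t: "Im t \<ge> 1"
      have "norm (qpoch (of_real \<rho>) (of_real \<rho>)) \<le> norm (qpoch (ei (2 * of_real y) * ei (2 * t)) (ei (2 * t)))"
        using q[OF t] \<rho> by (intro qpoch_norm_le) (auto simp: norm_mult norm_ei)
      moreover have "qpoch (ei (2 * of_real y)) (ei (2 * t)) =
          (1 - ei (2 * of_real y)) * qpoch (ei (2 * of_real y) * ei (2 * t)) (ei (2 * t))"
        using t by (intro qpoch_Suc norm_ei_less_1) auto
      ultimately show "norm (1 - ei (2 * of_real y)) * norm (qpoch (of_real \<rho>) (of_real \<rho>)) \<le>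
          norm (qpoch (ei (2 * z t)) (ei (2 * t)))"
        unfolding z by (simp add: norm_mult mult_left_mono)
    qed
  qed
  then obtain \<delta> where \<delta>: "\<delta> > 0" "\<And>t. Im t \<ge> 1 \<Longrightarrow> \<delta> \<le> norm (qpoch (ei (2 * z t)) (ei (2 * t)))" by blast
  define \<delta>' where "\<delta>' = norm (qpoch (of_real (exp (- 2 * pi * (1 - f)))) (of_real \<rho>))"
  have \<delta>': "\<delta>' > 0" unfolding \<delta>'_def using nz[of "exp (- 2 * pi * (1 - f))"] f by simp
  show ?thesis
  proof (intro exI[of _ "1 / (\<delta> * \<delta>')"] conjI allI impI)
    fix t :: complex assume t: "Im t \<ge> 1"
    have "exp (pi * f * (1 - f) * Im t) * (\<delta> * \<delta>') \<le> exp (pi * f * (1 - f) * Im t) *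
        (norm (qpoch (ei (2 * z t)) (ei (2 * t))) * norm (qpoch (ei (2 * t - 2 * z t)) (ei (2 * t))))"
      using \<delta> \<delta>' second[OF t] t unfolding \<delta>'_def[symmetric] by (intro mult_left_mono mult_mono) auto
    also have "\<dots> = norm (siegel x y t)" unfolding norm_siegel[OF t] by simp
    finally have "1 / norm (siegel x y t) \<le> 1 / (exp (pi * f * (1 - f) * Im t) * (\<delta> * \<delta>'))"
      using \<delta>(1) \<delta>' by (intro frac_le) auto
    moreover have "- pi * f * (1 - f) * Im t = - (pi * f * (1 - f) * Im t)" by simp
    ultimately show "norm (1 / siegel x y t) \<le> 1 / (\<delta> * \<delta>') * exp (- pi * frac x * (1 - frac x) * Im t)"
      unfolding f_def[symmetric] by (simp only: exp_minus) (simp add: norm_inverse divide_inverse mult_ac)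
  qed (use \<delta> \<delta>' in auto)
qed

text \<open>The factor ei(-2t) supplies the twelve factors ei(t/6) that separate
  \<open>siegel\<close> from the classical Siegel functions.\<close>

definition siegel_quotient :: "nat set \<Rightarrow> int \<Rightarrow> int \<Rightarrow> complex \<Rightarrow> complex" where
  "siegel_quotient R c d t =
     ei (- 2 * t) / (\<Prod>s\<in>R. siegel (of_int (int s * c) / 60) (of_int (int s * d) / 60) t)"

text \<open>Twelve residues absorb the multiplier of the inversion and the sign of (c, d) -> (-c,
  -d); the two divisibility conditions cancel the roots of unity that appear when c or d is shifted
  by 60.\<close>

definition admissible :: "nat set \<Rightarrow> bool" where
  "admissible R \<longleftrightarrow> R \<subseteq> {1..29} \<and> card R = 12 \<and> even (\<Sum>s\<in>R. int s) \<and> 120 dvd (\<Sum>s\<in>R. (int s)\<^sup>2)"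

definition primitive :: "int \<Rightarrow> int \<Rightarrow> bool" where
  "primitive c d \<longleftrightarrow> gcd c (gcd d 60) = 1"

lemma siegel_quotient_translate: "siegel_quotient R c d (t + 1) = siegel_quotient R c (c + d) t"
proof -
  have "ei 2 = 1" using ei_eq_1_iff[of 2] by (auto intro: exI[of _ 1])
  hence "ei (- 2 * (t + 1)) = ei (- 2 * t)" by (simp add: ring_distribs ei_diff)
  thus ?thesis
    by (simp add: siegel_quotient_def siegel_translate add_divide_distrib ring_distribs)
qed

lemma siegel_quotient_inversion:
  assumes R: "admissible R" and t: "Im t > 0"
  shows "siegel_quotient R c d (- 1 / t) = siegel_quotient R d (- c) t"
proof -
  obtain k where k: "\<And>x y. siegel x y (- 1 / t) = k * siegel y (- x) t" "k ^ 12 = ei (2 / t + 2 * t)"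
    using siegel_inversion[OF t] by blast
  have "(\<Prod>s\<in>R. siegel (of_int (int s * c) / 60) (of_int (int s * d) / 60) (- 1 / t)) =
     ei (2 / t + 2 * t) * (\<Prod>s\<in>R. siegel (of_int (int s * d) / 60) (of_int (int s * - c) / 60) t)"
    unfolding k(1) prod.distrib k(2)[symmetric] using R by (simp add: admissible_def)
  moreover have "ei (- 2 * (- 1 / t)) = ei (2 / t + 2 * t) * ei (- 2 * t)"
    unfolding ei_add[symmetric] by simp
  ultimately show ?thesis unfolding siegel_quotient_def by (simp only:) simp
qed

lemma siegel_quotient_periodic:
  assumes R: "admissible R" and t: "Im t > 0"
  shows "siegel_quotient R (c + 60 * i) d t = siegel_quotient R c d t"
    and "siegel_quotient R c (d + 60 * j) t = siegel_quotient R c d t"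
proof -
  obtain a b where a: "(\<Sum>s\<in>R. int s) = 2 * a" and b: "(\<Sum>s\<in>R. (int s)\<^sup>2) = 120 * b"
    using R by (auto simp: admissible_def elim!: evenE dvdE)
  have ev: "ei (of_int (2 * n)) = 1" for n using ei_of_int[of "2 * n"] by simp
  \<comment> \<open>The exponents add up to m times the sum of s, plus m k / 60 times the sum of
    s^2, which is an even integer for admissible \<open>R\<close>.\<close>
  have one: "(\<Prod>s\<in>R. ei (of_int (int s * m) * (1 + of_int (int s * k) / 60))) = 1" for m k
  proof -
    have "(\<Prod>s\<in>R. ei (of_int (int s * m) * (1 + of_int (int s * k) / 60))) =
       ei (of_int m * of_int (\<Sum>s\<in>R. int s) + of_int (m * k) * of_int (\<Sum>s\<in>R. (int s)\<^sup>2) / 60)"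
      unfolding ei_sum[symmetric]
      by (intro arg_cong[of _ _ ei])
         (simp add: ring_distribs sum.distrib sum_distrib_left sum_divide_distrib power2_eq_square mult_ac)
    also have "\<dots> = ei (of_int (2 * (m * a + m * k * b)))"
      unfolding a b by (intro arg_cong[of _ _ ei]) (simp add: algebra_simps)
    finally show ?thesis unfolding ev .
  qed
  have "(\<Prod>s\<in>R. siegel (of_int (int s * (c + 60 * i)) / 60) (of_int (int s * d) / 60) t) =
     (\<Prod>s\<in>R. ei (of_int (int s * i) * (1 + of_int (int s * - d) / 60)) *
         siegel (of_int (int s * c) / 60) (of_int (int s * d) / 60) t)"
  proof (intro prod.cong refl)
    fix s
    show "siegel (of_int (int s * (c + 60 * i)) / 60) (of_int (int s * d) / 60) t =
       ei (of_int (int s * i) * (1 + of_int (int s * - d) / 60)) *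
         siegel (of_int (int s * c) / 60) (of_int (int s * d) / 60) t"
      using siegel_plus_int_left[OF t, of "of_int (int s * c) / 60" "int s * i" "of_int (int s * d) / 60"]
      by (simp add: add_divide_distrib ring_distribs)
  qed
  thus "siegel_quotient R (c + 60 * i) d t = siegel_quotient R c d t"
    unfolding siegel_quotient_def prod.distrib one by simp
  have "(\<Prod>s\<in>R. siegel (of_int (int s * c) / 60) (of_int (int s * (d + 60 * j)) / 60) t) =
     (\<Prod>s\<in>R. ei (of_int (int s * j) * (1 + of_int (int s * c) / 60)) *
         siegel (of_int (int s * c) / 60) (of_int (int s * d) / 60) t)"
  proof (intro prod.cong refl)
    fix s
    show "siegel (of_int (int s * c) / 60) (of_int (int s * (d + 60 * j)) / 60) t =
       ei (of_int (int s * j) * (1 + of_int (int s * c) / 60)) *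
         siegel (of_int (int s * c) / 60) (of_int (int s * d) / 60) t"
      using siegel_plus_int_right[of "of_int (int s * c) / 60" "of_int (int s * d) / 60" "int s * j"]
      by (simp add: add_divide_distrib ring_distribs)
  qed
  thus "siegel_quotient R c (d + 60 * j) t = siegel_quotient R c d t"
    unfolding siegel_quotient_def prod.distrib one by simp
qed

lemma siegel_quotient_minus:
  assumes R: "admissible R" and t: "Im t > 0"
  shows "siegel_quotient R (- c) (- d) t = siegel_quotient R c d t"
proof -
  have "(\<Prod>s\<in>R. siegel (of_int (int s * - c) / 60) (of_int (int s * - d) / 60) t) =
     (\<Prod>s\<in>R. - 1 * siegel (of_int (int s * c) / 60) (of_int (int s * d) / 60) t)"
    using siegel_minus[OF t] by simp
  also have "\<dots> = (\<Prod>s\<in>R. siegel (of_int (int s * c) / 60) (of_int (int s * d) / 60) t)"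
    unfolding prod.distrib using R by (simp add: admissible_def)
  finally show ?thesis by (simp add: siegel_quotient_def)
qed

text \<open>If both were integers, 60 would divide s gcd(c, d, 60) = s. Thus no denominator of a
  Siegel quotient vanishes.\<close>

lemma not_Ints_of_primitive:
  assumes "primitive c d" "1 \<le> s" "s \<le> 29"
  shows "of_int (int s * c) / 60 \<notin> (\<int> :: real set) \<or> of_int (int s * d) / 60 \<notin> (\<int> :: real set)"
proof (rule ccontr)
  have dvd: "60 dvd n" if "of_int n / 60 \<in> (\<int> :: real set)" for n :: int
  proof -
    from that obtain k :: int where "of_int n / 60 = real_of_int k" by (auto elim: Ints_cases)
    hence "real_of_int n = of_int (60 * k)" by simp
    hence "n = 60 * k" by (simp only: of_int_eq_iff)
    thus ?thesis by simp
  qed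
  assume "\<not> ?thesis"
  hence "60 dvd int s * c" "60 dvd int s * d" using dvd by blast+
  hence "60 dvd gcd (int s * c) (gcd (int s * d) (int s * 60))" by simp
  also have "\<dots> = int s * gcd c (gcd d 60)" 
    using gcd_mult_distrib_int[of "int s" d 60] gcd_mult_distrib_int[of "int s" c "gcd d 60"] by simp
  finally have "60 dvd int s" using assms by (simp add: primitive_def)
  thus False using assms by (auto dest: zdvd_imp_le)
qed

lemma holomorphic_on_siegel_quotient:
  assumes "admissible R" "primitive c d"
  shows "siegel_quotient R c d holomorphic_on {t. Im t > 0}"
proof -
  have "finite R" using assms by (auto simp: admissible_def intro: finite_subset)
  moreover have "siegel (of_int (int s * c) / 60) (of_int (int s * d) / 60) t \<noteq> 0" if "s \<in> R" "Im t > 0" for s t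
    using not_Ints_of_primitive[OF assms(2), of s] siegel_eq_0_iff[OF that(2)] assms(1) that(1)
    by (auto simp: admissible_def)
  ultimately show ?thesis unfolding siegel_quotient_def[abs_def]
    by (intro holomorphic_intros) auto
qed

text \<open>
  The order of vanishing at \<open>i\<infinity>\<close> in the parameter \<open>e\<^sup>2\<^sup>\<pi>\<^sup>i\<^sup>t\<close>, multiplied by 7200 to make it integral.
\<close>

definition cusp_order :: "nat set \<Rightarrow> int \<Rightarrow> int" where
  "cusp_order R c = (\<Sum>s\<in>R. (int s * c mod 60) * (60 - int s * c mod 60)) - 7200"

text \<open>The growth rate depends on c alone: d affects only phases and the constant.\<close>

lemma siegel_quotient_bound:
  assumes R: "admissible R" and cd: "primitive c d"
  shows "\<exists>C\<ge>0. \<forall>t. Im t \<ge> 1 \<longrightarrow> norm (siegel_quotient R c d t) \<le> C * exp (- pi / 3600 * of_int (cusp_order R c) * Im t)"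
proof -
  have fin: "finite R" using R by (auto simp: admissible_def intro: finite_subset)
  let ?x = "\<lambda>s. of_int (int s * c) / (60::real)" and ?y = "\<lambda>s. of_int (int s * d) / (60::real)"
  have "\<forall>s\<in>R. \<exists>C\<ge>0. \<forall>t. Im t \<ge> 1 \<longrightarrow>
      norm (1 / siegel (?x s) (?y s) t) \<le> C * exp (- pi * frac (?x s) * (1 - frac (?x s)) * Im t)"
    using not_Ints_of_primitive[OF cd] R by (intro ballI siegel_lower_bound) (auto simp: admissible_def)
  then obtain C where C: "\<And>s. s \<in> R \<Longrightarrow> C s \<ge> 0"
    "\<And>s t. s \<in> R \<Longrightarrow> Im t \<ge> 1 \<Longrightarrow>
      norm (1 / siegel (?x s) (?y s) t) \<le> C s * exp (- pi * frac (?x s) * (1 - frac (?x s)) * Im t)"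
    by metis
  have fr: "frac (of_int n / 60) = of_int (n mod 60) / (60::real)" for n :: int
  proof -
    have "of_int n = (of_int (60 * (n div 60)) + of_int (n mod 60) :: real)"
      unfolding of_int_add[symmetric] by simp
    hence "of_int n / 60 - of_int (n mod 60) / 60 = (of_int (n div 60) :: real)" by (simp add: field_simps)
    moreover have "real_of_int (n mod 60) < 60" using pos_mod_bound[of 60 n] by linarith
    moreover have "0 \<le> real_of_int (n mod 60)" using pos_mod_sign[of 60 n] by simp
    ultimately show ?thesis by (subst frac_unique_iff) auto
  qed
  show ?thesis
  proof (intro exI[of _ "\<Prod>s\<in>R. C s"] conjI allI impI)
    show "0 \<le> (\<Prod>s\<in>R. C s)" using C by (intro prod_nonneg) auto
    fix t :: complex assume t: "Im t \<ge> 1"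
    have "norm (siegel_quotient R c d t) = exp (2 * pi * Im t) * (\<Prod>s\<in>R. norm (1 / siegel (?x s) (?y s) t))"
      by (simp add: siegel_quotient_def norm_divide norm_ei prod_dividef prod_norm)
    also have "\<dots> \<le> exp (2 * pi * Im t) * (\<Prod>s\<in>R. C s * exp (- pi * frac (?x s) * (1 - frac (?x s)) * Im t))"
      using C t by (intro mult_left_mono prod_mono) auto
    also have "\<dots> = (\<Prod>s\<in>R. C s) * exp (2 * pi * Im t + (\<Sum>s\<in>R. - pi * frac (?x s) * (1 - frac (?x s)) * Im t))"
      using fin by (simp add: prod.distrib exp_add exp_sum)
    also have "2 * pi * Im t + (\<Sum>s\<in>R. - pi * frac (?x s) * (1 - frac (?x s)) * Im t) =
       - pi / 3600 * of_int (cusp_order R c) * Im t"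
    proof -
      have "(\<Sum>s\<in>R. - pi * frac (?x s) * (1 - frac (?x s)) * Im t) =
         (\<Sum>s\<in>R. - (pi * Im t / 3600) * of_int ((int s * c mod 60) * (60 - int s * c mod 60)))"
        unfolding fr by (intro sum.cong) (simp_all add: field_simps)
      also have "\<dots> = - (pi * Im t / 3600) * of_int (\<Sum>s\<in>R. (int s * c mod 60) * (60 - int s * c mod 60))"
        by (simp only: sum_distrib_left of_int_sum)
      finally show ?thesis by (simp add: cusp_order_def field_simps)
    qed
    finally show "norm (siegel_quotient R c d t) \<le> (\<Prod>s\<in>R. C s) * exp (- pi / 3600 * of_int (cusp_order R c) * Im t)" .
  qed
qed

section \<open>The residue classes modulo 60\<close>

definition S1 :: "nat set" where "S1 = {1, 4, 7, 10, 11, 13, 17, 18, 19, 24, 25, 27}"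
definition T1 :: "nat set" where "T1 = {1, 3, 7, 10, 11, 16, 17, 18, 23, 24, 25, 29}"
definition S2 :: "nat set" where "S2 = {1, 5, 6, 7, 8, 10, 11, 12, 17, 19, 21, 23}"
definition T2 :: "nat set" where "T2 = {1, 5, 6, 7, 9, 10, 11, 12, 13, 17, 28, 29}"
definition S3 :: "nat set" where "S3 = {6, 7, 8, 9, 10, 11, 12, 13, 19, 23, 25, 29}"
definition T3 :: "nat set" where "T3 = {1, 6, 10, 12, 13, 17, 19, 21, 23, 25, 28, 29}"
definition S4 :: "nat set" where "S4 = {3, 4, 5, 10, 11, 13, 17, 18, 19, 23, 24, 29}"
definition T4 :: "nat set" where "T4 = {1, 5, 7, 10, 13, 16, 18, 19, 23, 24, 27, 29}"

lemmas residue_set_defs = S1_def T1_def S2_def T2_def S3_def T3_def S4_def T4_def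

lemma admissible_residue_sets:
  "admissible S1" "admissible T1" "admissible S2" "admissible T2"
  "admissible S3" "admissible T3" "admissible S4" "admissible T4"
  by (simp_all add: admissible_def residue_set_defs)

text \<open>The variable q = ei(t/30) satisfies q^60 = ei(2t), so one power of q has order 120 =
  7200/60 in the scale of \<open>cusp_order\<close>.\<close>

lemma siegel_quotient_at_1:
  assumes R: "R \<subseteq> {1..29}" and t: "Im t > 0" and k: "cusp_order R 1 = 120 * k"
  shows "siegel_quotient R 1 0 t = ei (of_int k * t / 30) / residue_product R (ei (t / 30))"
proof -
  have fin: "finite R" using R finite_subset by blast
  have q60: "ei (2 * t) = ei (t / 30) ^ 60" by (simp add: ei_power)
  have s: "siegel (of_int (int s * 1) / 60) (of_int (int s * 0) / 60) t = ei (- (t / 3600) * of_int (int s * (60 - int s))) *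
      (qpoch (ei (t / 30) ^ s) (ei (t / 30) ^ 60) * qpoch (ei (t / 30) ^ (60 - s)) (ei (t / 30) ^ 60))"
    if "s \<in> R" for s
  proof -
    have le: "s \<le> 60" using that R by force
    define z where "z = of_nat s * t / 60"
    have z: "ei (2 * z) = ei (t / 30) ^ s" "ei (2 * t - 2 * z) = ei (t / 30) ^ (60 - s)"
      using le by (simp_all add: ei_power z_def of_nat_diff algebra_simps)
    have "siegel (of_int (int s * 1) / 60) (of_int (int s * 0) / 60) t = (ei (of_nat s / 60 * z) * ei (- z)) *
      (qpoch (ei (t / 30) ^ s) (ei (t / 30) ^ 60) * qpoch (ei (t / 30) ^ (60 - s)) (ei (t / 30) ^ 60))"
      unfolding z[symmetric] q60[symmetric] by (simp add: siegel_def psi_def z_def)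
    also have "ei (of_nat s / 60 * z) * ei (- z) = ei (- (t / 3600) * of_int (int s * (60 - int s)))"
      unfolding ei_add[symmetric] by (intro arg_cong[of _ _ ei]) (simp add: z_def field_simps)
    finally show ?thesis .
  qed
  have "cusp_order R 1 = (\<Sum>s\<in>R. int s * (60 - int s)) - 7200"
    unfolding cusp_order_def using R by (intro arg_cong2[of _ _ _ _ "(-)"] sum.cong) force+
  hence k': "(\<Sum>s\<in>R. int s * (60 - int s)) = 7200 + 120 * k" using k by simp
  have "(\<Prod>s\<in>R. siegel (of_int (int s * 1) / 60) (of_int (int s * 0) / 60) t) =
     ei (- (t / 3600) * of_int (\<Sum>s\<in>R. int s * (60 - int s))) * residue_product R (ei (t / 30))"
    by (simp only: s prod.distrib ei_sum[symmetric] sum_distrib_left of_int_sum residue_product_def cong: prod.cong)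
  also have "ei (- (t / 3600) * of_int (\<Sum>s\<in>R. int s * (60 - int s))) = ei (- 2 * t - of_int k * t / 30)"
    unfolding k' by (intro arg_cong[of _ _ ei]) (simp add: field_simps)
  finally show ?thesis unfolding siegel_quotient_def by (simp only: ei_diff) simp
qed

section \<open>Action of the units modulo 60 on the residue sets\<close>

definition torsion_value :: "int \<Rightarrow> complex \<Rightarrow> complex" where
  "torsion_value n t = siegel (of_int n / 60) 0 t"

lemma siegel_quotient_conv_torsion_value:
  "siegel_quotient R u 0 t = ei (- 2 * t) / (\<Prod>s\<in>R. torsion_value (int s * u) t)"
  by (simp add: siegel_quotient_def torsion_value_def)

text \<open>Both n -> n + 60 and n -> -n change the sign, so n -> 60 - n changes nothing, and every
  index folds into 0..30.\<close>

lemma torsion_value_reduce: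
  assumes t: "Im t > 0"
  shows "torsion_value n t = (if even (n div 60) then 1 else - 1) *
    torsion_value (if n mod 60 \<le> 30 then n mod 60 else 60 - n mod 60) t"
proof -
  have add: "torsion_value (n + 60 * m) t = (if even m then 1 else - 1) * torsion_value n t" for n m
    using siegel_plus_int_left[OF t, of "of_int n / 60" m 0] ei_of_int[of m]
    by (simp add: torsion_value_def add_divide_distrib)
  have "torsion_value (60 - n) t = torsion_value n t" for n
    using add[of "- n" 1] siegel_minus[OF t, of "of_int n / 60" 0] by (simp add: torsion_value_def)
  thus ?thesis using add[of "n mod 60" "n div 60"] by auto
qed

text \<open>Modulo sign, the units fall into the cosets {1, 11}, {7, 17}, {13, 23}, {19, 29} of the
  group generated by 11, one for each identity. Where the signs change, the roles of the two sets
  are exchanged as well, so the difference of the quotients always has the orientation of the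
  identity.\<close>

lemma siegel_quotient_units:
  assumes t: "Im t > 0"
  shows
    "siegel_quotient S1 7 0 t = - siegel_quotient T2 1 0 t"
    "siegel_quotient T1 7 0 t = - siegel_quotient S2 1 0 t"
    "siegel_quotient S1 11 0 t = - siegel_quotient T1 1 0 t"
    "siegel_quotient T1 11 0 t = - siegel_quotient S1 1 0 t"
    "siegel_quotient S1 13 0 t = siegel_quotient S3 1 0 t"
    "siegel_quotient T1 13 0 t = siegel_quotient T3 1 0 t"
    "siegel_quotient S1 17 0 t = siegel_quotient S2 1 0 t"
    "siegel_quotient T1 17 0 t = siegel_quotient T2 1 0 t"
    "siegel_quotient S1 19 0 t = - siegel_quotient T4 1 0 t"
    "siegel_quotient T1 19 0 t = - siegel_quotient S4 1 0 t"
    "siegel_quotient S1 23 0 t = - siegel_quotient T3 1 0 t"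
    "siegel_quotient T1 23 0 t = - siegel_quotient S3 1 0 t"
    "siegel_quotient S1 29 0 t = siegel_quotient S4 1 0 t"
    "siegel_quotient T1 29 0 t = siegel_quotient T4 1 0 t"
proof -
  \<comment> \<open>The guard restricts the rewriting to indices still to be folded, so that
    simplification terminates.\<close>
  have red: "torsion_value (numeral n) t = (if even (numeral n div 60 :: int) then 1 else - 1) *
    torsion_value (if numeral n mod 60 \<le> (30 :: int) then numeral n mod 60 else 60 - numeral n mod 60) t"
    if "30 < (numeral n :: int)" for n
    by (rule torsion_value_reduce[OF t])
  show "siegel_quotient S1 7 0 t = - siegel_quotient T2 1 0 t"
    "siegel_quotient T1 7 0 t = - siegel_quotient S2 1 0 t"
    "siegel_quotient S1 11 0 t = - siegel_quotient T1 1 0 t"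
    "siegel_quotient T1 11 0 t = - siegel_quotient S1 1 0 t"
    "siegel_quotient S1 13 0 t = siegel_quotient S3 1 0 t"
    "siegel_quotient T1 13 0 t = siegel_quotient T3 1 0 t"
    "siegel_quotient S1 17 0 t = siegel_quotient S2 1 0 t"
    "siegel_quotient T1 17 0 t = siegel_quotient T2 1 0 t"
    "siegel_quotient S1 19 0 t = - siegel_quotient T4 1 0 t"
    "siegel_quotient T1 19 0 t = - siegel_quotient S4 1 0 t"
    "siegel_quotient S1 23 0 t = - siegel_quotient T3 1 0 t"
    "siegel_quotient T1 23 0 t = - siegel_quotient S3 1 0 t"
    "siegel_quotient S1 29 0 t = siegel_quotient S4 1 0 t"
    "siegel_quotient T1 29 0 t = siegel_quotient T4 1 0 t"
    unfolding siegel_quotient_conv_torsion_value residue_set_defs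
    by (simp_all add: red mult_ac)
qed

section \<open>Expansions at the unit cusps\<close>

text \<open>The coefficients of U(R) - U(R') - 1 multiplied by q^j: \<open>k\<close> is the shift of
  the partition identity and \<open>j\<close> its exceptional degree. The pairs (k, j) for (i)-(iv)
  are (1, 0), (0, 8), (6, 0), (3, 0).\<close>

definition discrepancy :: "nat set \<Rightarrow> nat set \<Rightarrow> nat \<Rightarrow> nat \<Rightarrow> nat \<Rightarrow> int" where
  "discrepancy R R' k j n = int (num_partitions (pm_residues (int ` R) 60) n)
     - (if k \<le> n then int (num_partitions (pm_residues (int ` R') 60) (n - k)) else 0)
     - (if n = j then 1 else 0)"

lemma sums_discrepancy:
  assumes R: "R \<subseteq> {1..29}" "R' \<subseteq> {1..29}" and q: "norm q < 1"
  shows "(\<lambda>n. of_int (discrepancy R R' k j n) * q ^ n) sums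
     (1 / residue_product R q - q ^ k / residue_product R' q - q ^ j)"
proof -
  let ?p = "\<lambda>n. num_partitions (pm_residues (int ` R) 60) n"
  let ?p' = "\<lambda>n. num_partitions (pm_residues (int ` R') 60) n"
  have "(\<lambda>n. q ^ k * (of_nat (?p' n) * q ^ n)) sums (q ^ k * (1 / residue_product R' q))"
    by (intro sums_mult sums_num_partitions_pm_residues R q)
  hence "(\<lambda>n. (if k \<le> n + k then of_nat (?p' (n + k - k)) else 0) * q ^ (n + k)) sums (q ^ k / residue_product R' q)"
    by (simp add: power_add mult_ac)
  hence 1: "(\<lambda>n. (if k \<le> n then of_nat (?p' (n - k)) else 0) * q ^ n) sums (q ^ k / residue_product R' q)"
    by (subst (asm) sums_zero_iff_shift[where n = k and f = "\<lambda>n. (if k \<le> n then of_nat (?p' (n - k)) else 0) * q ^ n"]) auto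
  have 2: "(\<lambda>n. if n = j then q ^ n else 0) sums (q ^ j)"
    by (rule sums_single)
  have "(\<lambda>n. of_nat (?p n) * q ^ n - (if k \<le> n then of_nat (?p' (n - k)) else 0) * q ^ n
      - (if n = j then q ^ n else 0)) sums (1 / residue_product R q - q ^ k / residue_product R' q - q ^ j)"
    by (intro sums_diff 1 2 sums_num_partitions_pm_residues R q)
  moreover have "of_nat (?p n) * q ^ n - (if k \<le> n then of_nat (?p' (n - k)) else 0) * q ^ n
      - (if n = j then q ^ n else 0) = of_int (discrepancy R R' k j n) * q ^ n" for n
    by (simp add: discrepancy_def algebra_simps)
  ultimately show ?thesis by simp
qed

lemma powser_norm_le_power:
  fixes a :: "nat \<Rightarrow> complex"
  assumes sums: "\<And>q. norm q < 1 \<Longrightarrow> (\<lambda>n. a n * q ^ n) sums f q"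
    and a: "\<And>n. n < m \<Longrightarrow> a n = 0" and \<rho>: "0 \<le> \<rho>" "\<rho> < 1"
  shows "\<exists>C\<ge>0. \<forall>q. norm q \<le> \<rho> \<longrightarrow> norm (f q) \<le> C * norm q ^ m"
proof -
  obtain \<sigma> where \<sigma>: "\<rho> < \<sigma>" "\<sigma> < 1" using dense \<rho> by blast
  have "norm (complex_of_real \<rho>) < norm (complex_of_real \<sigma>)" using \<rho> \<sigma> by simp
  hence "summable (\<lambda>n. norm (a n * of_real \<rho> ^ n))"
    using sums_summable[OF sums[of "of_real \<sigma>"]] \<rho> \<sigma> by (intro powser_insidea) auto
  hence s\<rho>: "summable (\<lambda>n. norm (a n) * \<rho> ^ n)" using \<rho> by (simp add: norm_mult norm_power)
  have s: "summable (\<lambda>n. norm (a (n + m)) * \<rho> ^ n)"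
  proof (cases "\<rho> = 0")
    case True
    thus ?thesis by (intro summable_finite[of "{0}"]) auto
  next
    case False
    have "summable (\<lambda>n. (norm (a (n + m)) * \<rho> ^ (n + m)) * (1 / \<rho> ^ m))"
      using summable_mult2[OF summable_ignore_initial_segment[OF s\<rho>]] .
    thus ?thesis using False by (simp add: power_add)
  qed
  show ?thesis
  proof (intro exI[of _ "\<Sum>n. norm (a (n + m)) * \<rho> ^ n"] conjI allI impI)
    show "0 \<le> (\<Sum>n. norm (a (n + m)) * \<rho> ^ n)" using s \<rho> by (intro suminf_nonneg) auto
    fix q :: complex assume q: "norm q \<le> \<rho>"
    have le: "norm (a (n + m) * q ^ n) \<le> norm (a (n + m)) * \<rho> ^ n" for n
      using q by (auto simp: norm_mult norm_power intro!: mult_left_mono power_mono)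
    have sq: "summable (\<lambda>n. norm (a (n + m) * q ^ n))"
      by (rule summable_comparison_test'[OF s, of 0]) (use le in auto)
    have "(\<lambda>n. a (n + m) * q ^ (n + m)) sums f q"
      using sums[of q] q \<rho> a by (subst sums_zero_iff_shift) auto
    moreover have "(\<lambda>n. q ^ m * (a (n + m) * q ^ n)) sums (q ^ m * (\<Sum>n. a (n + m) * q ^ n))"
      using summable_norm_cancel[OF sq] by (intro sums_mult summable_sums)
    hence "(\<lambda>n. a (n + m) * q ^ (n + m)) sums (q ^ m * (\<Sum>n. a (n + m) * q ^ n))"
      by (simp add: power_add mult_ac)
    ultimately have "f q = q ^ m * (\<Sum>n. a (n + m) * q ^ n)" by (rule sums_unique2)
    moreover have "norm (\<Sum>n. a (n + m) * q ^ n) \<le> (\<Sum>n. norm (a (n + m)) * \<rho> ^ n)"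
      using summable_norm[OF sq] suminf_le[OF le sq s] by linarith
    ultimately show "norm (f q) \<le> (\<Sum>n. norm (a (n + m)) * \<rho> ^ n) * norm q ^ m"
      by (simp add: norm_mult norm_power mult_left_mono mult.commute)
  qed
qed

text \<open>The leading powers q^(-j) and q^(k-j) are dictated by the cusp orders. For (ii) the
  order -960 = -8 times 120 turns the constant 1 into q^8, which is why n = 8 is the
  exception.\<close>

lemma siegel_quotient_diff_eq:
  assumes R: "R \<subseteq> {1..29}" "R' \<subseteq> {1..29}" and t: "Im t > 0"
    and ord: "cusp_order R 1 = - 120 * int j" "cusp_order R' 1 = 120 * (int k - int j)"
  defines "q \<equiv> ei (t / 30)"
  shows "siegel_quotient R 1 0 t - siegel_quotient R' 1 0 t - 1 =
    (1 / residue_product R q - q ^ k / residue_product R' q - q ^ j) / q ^ j"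
proof -
  have 1: "siegel_quotient R 1 0 t = ei (of_int (- int j) * t / 30) / residue_product R q"
    unfolding q_def using ord by (intro siegel_quotient_at_1 R t) simp
  have 2: "siegel_quotient R' 1 0 t = ei (of_int (int k - int j) * t / 30) / residue_product R' q"
    unfolding q_def using ord by (intro siegel_quotient_at_1 R t) simp
  have 3: "ei (of_int (- int j) * t / 30) = 1 / q ^ j"
    by (simp add: q_def ei_power ei_minus field_simps)
  have 4: "ei (of_int (int k - int j) * t / 30) = q ^ k / q ^ j"
    by (simp add: q_def ei_power diff_divide_distrib left_diff_distrib ei_diff)
  have "q ^ j \<noteq> 0" by (simp add: q_def)
  thus ?thesis unfolding 1 2 3 4 by (simp add: diff_divide_distrib mult.commute)
qed

lemma siegel_quotient_diff_bound:
  assumes R: "R \<subseteq> {1..29}" "R' \<subseteq> {1..29}"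
    and ord: "cusp_order R 1 = - 120 * int j" "cusp_order R' 1 = 120 * (int k - int j)"
    and disc: "\<And>n. n < j + m \<Longrightarrow> discrepancy R R' k j n = 0"
  shows "\<exists>C\<ge>0. \<forall>t. Im t \<ge> 1 \<longrightarrow> norm (siegel_quotient R 1 0 t - siegel_quotient R' 1 0 t - 1)
    \<le> C * exp (- pi / 3600 * of_int (120 * int m) * Im t)"
proof -
  define H where "H q = 1 / residue_product R q - q ^ k / residue_product R' q - q ^ j" for q
  have "\<exists>C\<ge>0. \<forall>q. norm q \<le> exp (- pi / 30) \<longrightarrow> norm (H q) \<le> C * norm q ^ (j + m)"
    using sums_discrepancy[OF R] disc unfolding H_def
    by (intro powser_norm_le_power[where a = "\<lambda>n. of_int (discrepancy R R' k j n)"]) auto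
  then obtain C where C: "C \<ge> 0" "\<And>q. norm q \<le> exp (- pi / 30) \<Longrightarrow> norm (H q) \<le> C * norm q ^ (j + m)" by blast
  show ?thesis
  proof (intro exI[of _ C] conjI allI impI)
    fix t :: complex assume t: "Im t \<ge> 1"
    define q where "q = ei (t / 30)"
    have nq: "norm q = exp (- pi * Im t / 30)" by (simp add: q_def norm_ei)
    hence "norm q \<le> exp (- pi / 30)" using t by simp
    from C(2)[OF this] have "norm (H q) / norm q ^ j \<le> C * norm q ^ (j + m) / norm q ^ j"
      by (intro divide_right_mono) auto
    also have "\<dots> = C * norm q ^ m" by (simp add: power_add q_def)
    also have "norm q ^ m = exp (- pi / 3600 * of_int (120 * int m) * Im t)"
      unfolding nq by (simp flip: exp_of_nat_mult)
    finally show "norm (siegel_quotient R 1 0 t - siegel_quotient R' 1 0 t - 1)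
        \<le> C * exp (- pi / 3600 * of_int (120 * int m) * Im t)"
      using siegel_quotient_diff_eq[OF R _ ord, of t] t
      by (simp add: H_def q_def norm_divide norm_power)
  qed (use C in auto)
qed

text \<open>A power series with zero constant term and some nonzero coefficient has no zeros in a
  punctured disc around 0, but the series here vanishes at every ei(t/30).\<close>

lemma discrepancy_eq_0:
  assumes R: "R \<subseteq> {1..29}" "R' \<subseteq> {1..29}"
    and ord: "cusp_order R 1 = - 120 * int j" "cusp_order R' 1 = 120 * (int k - int j)"
    and zero: "\<And>t. Im t > 0 \<Longrightarrow> siegel_quotient R 1 0 t - siegel_quotient R' 1 0 t - 1 = 0"
    and disc0: "discrepancy R R' k j 0 = 0"
  shows "discrepancy R R' k j n = 0"
proof (rule ccontr)
  assume n: "discrepancy R R' k j n \<noteq> 0"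
  define H where "H q = 1 / residue_product R q - q ^ k / residue_product R' q - q ^ j" for q
  have sums: "(\<lambda>n. of_int (discrepancy R R' k j n) * q ^ n) sums H q" if "norm q < 1" for q
    unfolding H_def by (rule sums_discrepancy[OF R that])
  have "H 0 = of_int (discrepancy R R' k j 0)"
    using sums_unique2[OF sums[of 0] powser_sums_zero[of "\<lambda>n. of_int (discrepancy R R' k j n)"]] by simp
  hence H0: "H 0 = 0" using disc0 by simp
  have "n > 0" using n disc0 by (cases n) auto
  obtain s where s: "0 < s" "\<And>z. z \<in> cball 0 s - {0} \<Longrightarrow> H z \<noteq> 0"
    using powser_0_nonzero[of 1 0 "\<lambda>n. of_int (discrepancy R R' k j n)" H n] sums H0 n \<open>n > 0\<close> by auto
  define r where "r = min s (1/2)"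
  have r: "0 < r" "r < 1" "r \<le> s" using s by (auto simp: r_def)
  \<comment> \<open>The point on the imaginary axis with ei(t/30) = r.\<close>
  define t where "t = - 30 * \<i> * of_real (ln r) / of_real pi"
  have "Im t = - 30 * ln r / pi" by (simp add: t_def)
  hence t: "Im t > 0" using r by (simp add: divide_neg_pos)
  have "of_real pi * \<i> * (t / 30) = of_real (ln r)" by (simp add: t_def)
  hence q: "ei (t / 30) = of_real r" using r by (simp only: ei_def exp_of_real) simp
  have "H (of_real r) / of_real r ^ j = 0"
    using siegel_quotient_diff_eq[OF R t ord] zero[OF t] by (simp add: H_def q)
  hence "H (of_real r) = 0" using r by simp
  moreover have "complex_of_real r \<in> cball 0 s - {0}" using r by simp
  ultimately show False using s by blast
qed

section \<open>Initial coefficients of the four identities\<close>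

lemma num_partitions_pm_residues_small:
  assumes R: "R \<subseteq> {1..29}" and n: "n \<le> 30"
  shows "num_partitions (pm_residues (int ` R) 60) n = num_partitions R n"
proof (rule num_partitions_cong, rule set_eqI)
  fix a
  have "60 - a \<notin> R" if "a \<le> n"
  proof
    assume "60 - a \<in> R"
    hence "60 - a \<le> 29" using R by auto
    thus False using that n by linarith
  qed
  moreover have "a > 0" if "a \<in> R" using that R by auto
  ultimately show "a \<in> pm_residues (int ` R) 60 \<inter> {..n} \<longleftrightarrow> a \<in> R \<inter> {..n}"
    using pm_residues_60_iff[OF R, of a] n by auto
qed

lemma residue_sets_subset:
  "S1 \<subseteq> {1..29}" "T1 \<subseteq> {1..29}" "S2 \<subseteq> {1..29}" "T2 \<subseteq> {1..29}"
  "S3 \<subseteq> {1..29}" "T3 \<subseteq> {1..29}" "S4 \<subseteq> {1..29}" "T4 \<subseteq> {1..29}"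
  by (simp_all add: residue_set_defs)

lemma discrepancy_0:
  assumes R: "R \<subseteq> {1..29}" and "0 < k"
  shows "discrepancy R R' k 0 0 = 0"
proof -
  have "0 \<notin> pm_residues (int ` R) 60" by (simp add: pm_residues_def)
  thus ?thesis using assms(2) by (simp add: discrepancy_def num_partitions_0)
qed

text \<open>Up to 8 the two sets differ only in the part 8, which adds exactly one partition of 8;
  this cancels the exceptional term.\<close>

lemma discrepancy_2: "n < 9 \<Longrightarrow> discrepancy S2 T2 0 8 n = 0"
proof (cases "n = 8")
  case True
  have "num_partitions S2 8 = num_partitions (insert 8 T2) 8"
    by (rule num_partitions_cong) (auto simp: residue_set_defs)
  also have "\<dots> = num_partitions T2 8 + 1"
    using num_partitions_insert[of 8 T2 8] num_partitions_0[of "insert 8 T2"]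
    by (simp add: residue_set_defs)
  finally show ?thesis using True
    by (simp add: discrepancy_def num_partitions_pm_residues_small[OF residue_sets_subset(3)]
        num_partitions_pm_residues_small[OF residue_sets_subset(4)])
next
  case False
  assume "n < 9"
  with False have "n \<le> 7" by simp
  have "num_partitions S2 n = num_partitions T2 n"
    using \<open>n \<le> 7\<close> by (intro num_partitions_cong) (auto simp: residue_set_defs)
  thus ?thesis using False \<open>n \<le> 7\<close>
    by (simp add: discrepancy_def num_partitions_pm_residues_small[OF residue_sets_subset(3)]
        num_partitions_pm_residues_small[OF residue_sets_subset(4)])
qed

text \<open>The smallest part of \<open>S3\<close> is 6, and its single partition of 6 matches the
  empty partition on the other side. Degree 6 is decisive: vanishing only for n < 6 would make the
  total in \<open>sum_order_bound\<close> exactly 0.\<close>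

lemma discrepancy_3: "n < 7 \<Longrightarrow> discrepancy S3 T3 6 0 n = 0"
proof -
  assume n: "n < 7"
  consider "n = 0" | "0 < n" "n < 6" | "n = 6" using n by linarith
  thus ?thesis
  proof cases
    case 1
    thus ?thesis using discrepancy_0[of S3 6 T3] residue_sets_subset by simp
  next
    case 2
    have "num_partitions S3 n = num_partitions {} n"
      using 2 by (intro num_partitions_cong) (auto simp: residue_set_defs)
    thus ?thesis using 2 num_partitions_empty[of n]
      by (simp add: discrepancy_def num_partitions_pm_residues_small[OF residue_sets_subset(5)])
  next
    case 3
    have "num_partitions S3 6 = num_partitions {6} 6"
      by (intro num_partitions_cong) (auto simp: residue_set_defs)
    also have "\<dots> = 1"
      using num_partitions_insert[of 6 "{}" 6] num_partitions_0[of "{6}"] num_partitions_empty[of 6] by simp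
    finally have "num_partitions (pm_residues (int ` S3) 60) 6 = 1"
      by (simp add: num_partitions_pm_residues_small[OF residue_sets_subset(5)])
    moreover have "num_partitions (pm_residues (int ` T3) 60) 0 = 1"
      by (intro num_partitions_0) (simp add: pm_residues_def)
    ultimately show ?thesis using 3 by (simp add: discrepancy_def)
  qed
qed

lemma cusp_order_at_1:
  "cusp_order S1 1 = 0" "cusp_order T1 1 = 120"
  "cusp_order S2 1 = - 960" "cusp_order T2 1 = - 960"
  "cusp_order S3 1 = 0" "cusp_order T3 1 = 720"
  "cusp_order S4 1 = 0" "cusp_order T4 1 = 360"
  by (simp_all add: cusp_order_def residue_set_defs)

section \<open>Transformation and orders of the defect\<close>

definition defect :: "int \<Rightarrow> int \<Rightarrow> complex \<Rightarrow> complex" where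
  "defect c d t = siegel_quotient S1 c d t - siegel_quotient T1 c d t - 1"

lemma defect_translate: "defect c d (t + 1) = defect c (c + d) t"
  by (simp add: defect_def siegel_quotient_translate)

lemma defect_inversion: "Im t > 0 \<Longrightarrow> defect c d (- 1 / t) = defect d (- c) t"
  unfolding defect_def by (simp only: siegel_quotient_inversion admissible_residue_sets)

lemma defect_minus: "Im t > 0 \<Longrightarrow> defect (- c) (- d) t = defect c d t"
  by (simp add: defect_def siegel_quotient_minus admissible_residue_sets)

lemma defect_periodic:
  assumes "Im t > 0"
  shows "defect (c + 60 * i) d t = defect c d t" "defect c (d + 60 * j) t = defect c d t"
  using assms by (simp_all add: defect_def siegel_quotient_periodic admissible_residue_sets)

lemma defect_mod:
  assumes "Im t > 0"
  shows "defect (c mod 60) d t = defect c d t" "defect c (d mod 60) t = defect c d t"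
  using defect_periodic(1)[OF assms, of "c mod 60" "c div 60" d]
    defect_periodic(2)[OF assms, of c "d mod 60" "d div 60"] by simp_all

lemma defect_translate_int: "defect c d (t + of_int m) = defect c (d + m * c) t"
proof (induction m arbitrary: d rule: int_induct[where k = 0])
  case (step1 i)
  have "defect c d (t + of_int (i + 1)) = defect c (c + d) (t + of_int i)"
    using defect_translate[of c d "t + of_int i"] by (simp add: add_ac)
  thus ?case using step1.IH[of "c + d"] by (simp add: algebra_simps)
next
  case (step2 i)
  have "defect c (d - c) (t + of_int i) = defect c d (t + of_int (i - 1))"
    using defect_translate[of c "d - c" "t + of_int (i - 1)"] by (simp add: add_ac)
  thus ?case using step2.IH[of "d - c"] by (simp add: algebra_simps)
qed simp

lemma holomorphic_on_defect:
  "primitive c d \<Longrightarrow> defect c d holomorphic_on {t. Im t > 0}"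
  unfolding defect_def[abs_def]
  by (intro holomorphic_on_diff holomorphic_on_const holomorphic_on_siegel_quotient admissible_residue_sets)

lemma defect_units:
  assumes "Im t > 0"
  shows "u \<in> {1, 11} \<Longrightarrow> defect u 0 t = siegel_quotient S1 1 0 t - siegel_quotient T1 1 0 t - 1"
    and "u \<in> {7, 17} \<Longrightarrow> defect u 0 t = siegel_quotient S2 1 0 t - siegel_quotient T2 1 0 t - 1"
    and "u \<in> {13, 23} \<Longrightarrow> defect u 0 t = siegel_quotient S3 1 0 t - siegel_quotient T3 1 0 t - 1"
    and "u \<in> {19, 29} \<Longrightarrow> defect u 0 t = siegel_quotient S4 1 0 t - siegel_quotient T4 1 0 t - 1"
  by (auto simp: defect_def siegel_quotient_units[OF assms])

section \<open>Orders of the defect at the cusp\<close>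

definition defect_order_ge :: "int \<Rightarrow> int \<Rightarrow> int \<Rightarrow> bool" where
  "defect_order_ge c d e \<longleftrightarrow>
     (\<exists>C\<ge>0. \<forall>t. Im t \<ge> 1 \<longrightarrow> norm (defect c d t) \<le> C * exp (- pi / 3600 * of_int e * Im t))"

text \<open>If the coefficients vanish below degree j + m, division by q^j leaves order m in q, that
  is 120 m. Here m = 7 for (iii) and m = 1 for the others.\<close>

lemma defect_order_units:
  "u \<in> {1, 11} \<Longrightarrow> defect_order_ge u 0 120"
  "u \<in> {7, 17} \<Longrightarrow> defect_order_ge u 0 120"
  "u \<in> {13, 23} \<Longrightarrow> defect_order_ge u 0 840"
  "u \<in> {19, 29} \<Longrightarrow> defect_order_ge u 0 120"
proof -
  have *: "defect_order_ge u 0 (120 * int m)"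
    if "\<And>t. Im t > 0 \<Longrightarrow> defect u 0 t = siegel_quotient R 1 0 t - siegel_quotient R' 1 0 t - 1"
      "R \<subseteq> {1..29}" "R' \<subseteq> {1..29}"
      "cusp_order R 1 = - 120 * int j" "cusp_order R' 1 = 120 * (int k - int j)"
      "\<And>n. n < j + m \<Longrightarrow> discrepancy R R' k j n = 0" for u R R' j k m
  proof -
    have "defect u 0 t = siegel_quotient R 1 0 t - siegel_quotient R' 1 0 t - 1" if "Im t \<ge> 1" for t
      using that by (intro \<open>\<And>t. Im t > 0 \<Longrightarrow> defect u 0 t = _\<close>) simp
    thus ?thesis unfolding defect_order_ge_def using siegel_quotient_diff_bound[OF that(2-6)] by simp
  qed
  show "defect_order_ge u 0 120" if "u \<in> {1, 11}"
    using *[of u S1 T1 0 1 1] defect_units(1) that discrepancy_0[of S1 1 T1]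
    by (simp add: residue_sets_subset[simplified] cusp_order_at_1)
  show "defect_order_ge u 0 120" if "u \<in> {7, 17}"
    using *[of u S2 T2 8 0 1] defect_units(2) that discrepancy_2
    by (simp add: residue_sets_subset[simplified] cusp_order_at_1)
  show "defect_order_ge u 0 840" if "u \<in> {13, 23}"
    using *[of u S3 T3 0 6 7] defect_units(3) that discrepancy_3
    by (simp add: residue_sets_subset[simplified] cusp_order_at_1)
  show "defect_order_ge u 0 120" if "u \<in> {19, 29}"
    using *[of u S4 T4 0 3 1] defect_units(4) that discrepancy_0[of S4 3 T4]
    by (simp add: residue_sets_subset[simplified] cusp_order_at_1)
qed

text \<open>As c is invertible modulo 60, integer translations of t lead from (c, 0) to every (c,
  d), and they preserve Im t.\<close>

lemma defect_order_right:
  assumes "defect_order_ge c 0 e" "coprime c 60"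
  shows "defect_order_ge c d e"
proof -
  obtain m where "[c * m = 1] (mod 60)" using cong_solve_coprime_int[OF assms(2)] by blast
  hence "[c * m * d = 1 * d] (mod 60)" by (intro cong_mult cong_refl)
  hence m: "(m * d * c) mod 60 = d mod 60"
    by (simp add: unique_euclidean_semiring_class.cong_def mult_ac)
  have eq: "defect c d t = defect c 0 (t + of_int (m * d))" if "Im t \<ge> 1" for t
    using defect_translate_int[of c 0 t "m * d"] defect_mod(2)[of t c d] defect_mod(2)[of t c "m * d * c"] m that
    by simp
  obtain C where C: "C \<ge> 0" "\<And>t. Im t \<ge> 1 \<Longrightarrow> norm (defect c 0 t) \<le> C * exp (- pi / 3600 * of_int e * Im t)"
    using assms(1) unfolding defect_order_ge_def by blast
  show ?thesis unfolding defect_order_ge_def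
    using C(1) C(2)[of "t + of_int (m * d)" for t] eq by (intro exI[of _ C]) simp
qed

lemma defect_order_reflect:
  assumes "defect_order_ge c (- d) e"
  shows "defect_order_ge (60 - c) d e"
proof -
  have "defect (60 - c) d t = defect c (- d) t" if "Im t \<ge> 1" for t
    using defect_periodic(1)[of t "- c" 1 d] defect_minus[of t c "- d"] that by simp
  thus ?thesis using assms unfolding defect_order_ge_def by simp
qed

text \<open>The triangle inequality, with no cancellation between the terms; the constant 1 has
  order 0, whence \<open>e \<le> 0\<close>.\<close>

lemma defect_order_generic:
  assumes cd: "primitive c d" and e: "e \<le> 0" "e \<le> cusp_order S1 c" "e \<le> cusp_order T1 c"
  shows "defect_order_ge c d e"
proof -
  obtain C1 where C1: "C1 \<ge> 0"
    "\<And>t. Im t \<ge> 1 \<Longrightarrow> norm (siegel_quotient S1 c d t) \<le> C1 * exp (- pi / 3600 * of_int (cusp_order S1 c) * Im t)"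
    using siegel_quotient_bound[OF admissible_residue_sets(1) cd] by blast
  obtain C2 where C2: "C2 \<ge> 0"
    "\<And>t. Im t \<ge> 1 \<Longrightarrow> norm (siegel_quotient T1 c d t) \<le> C2 * exp (- pi / 3600 * of_int (cusp_order T1 c) * Im t)"
    using siegel_quotient_bound[OF admissible_residue_sets(2) cd] by blast
  show ?thesis unfolding defect_order_ge_def
  proof (intro exI[of _ "C1 + C2 + 1"] conjI allI impI)
    fix t :: complex assume t: "Im t \<ge> 1"
    define E where "E = exp (- pi / 3600 * of_int e * Im t)"
    have mono: "exp (- pi / 3600 * of_int a * Im t) \<le> E" if "e \<le> a" for a
    proof -
      have "pi / 3600 * Im t * of_int e \<le> pi / 3600 * Im t * of_int a"
        using that t by (intro mult_left_mono) auto
      thus ?thesis by (simp add: E_def mult_ac)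
    qed
    have "norm (defect c d t) \<le> norm (siegel_quotient S1 c d t) + norm (siegel_quotient T1 c d t) + 1"
      unfolding defect_def by (rule order_trans[OF norm_triangle_ineq4]) (simp add: norm_triangle_ineq4)
    also have "\<dots> \<le> C1 * E + C2 * E + E"
    proof (intro add_mono)
      show "norm (siegel_quotient S1 c d t) \<le> C1 * E"
        using order_trans[OF C1(2)[OF t] mult_left_mono[OF mono[OF e(2)] C1(1)]] .
      show "norm (siegel_quotient T1 c d t) \<le> C2 * E"
        using order_trans[OF C2(2)[OF t] mult_left_mono[OF mono[OF e(3)] C2(1)]] .
      show "1 \<le> E" using mono[OF e(1)] by simp
    qed
    finally show "norm (defect c d t) \<le> (C1 + C2 + 1) * exp (- pi / 3600 * of_int e * Im t)"
      by (simp add: E_def algebra_simps)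
  qed (use C1 C2 in auto)
qed

text \<open>
  For \<open>c\<close> coprime to 60 the values come from the expansions of the four identities; otherwise they are
  the minimum of 0 and the two cusp orders.
\<close>

definition order_bound :: "int \<Rightarrow> int" where
  "order_bound c =
     (if c \<in> {1, 11, 49, 59, 7, 17, 43, 53, 19, 29, 31, 41} then 120
      else if c \<in> {13, 23, 37, 47} then 840
      else if c = 0 then - 7200
      else if c \<in> {5, 55} then - 600
      else if c \<in> {10, 50} then - 1200
      else if c \<in> {18, 42} then - 720
      else 0)"

lemma order_bound_le_cusp_order:
  assumes "c \<in> {0..59}" "c \<notin> {1, 11, 49, 59, 7, 17, 43, 53, 19, 29, 31, 41, 13, 23, 37, 47}"
  shows "order_bound c \<le> 0" "order_bound c \<le> cusp_order S1 c" "order_bound c \<le> cusp_order T1 c"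
proof -
  have "c \<in> set [0..59]" using assms(1) by simp
  hence "c \<in> {0, 2, 3, 4, 5, 6, 8, 9, 10, 12, 14, 15, 16, 18, 20, 21, 22, 24, 25, 26, 27, 28, 30, 32, 33, 34, 35,
      36, 38, 39, 40, 42, 44, 45, 46, 48, 50, 51, 52, 54, 55, 56, 57, 58}"
    using assms(2) by (simp add: upto.simps del: set_upto)
  thus "order_bound c \<le> 0" "order_bound c \<le> cusp_order S1 c" "order_bound c \<le> cusp_order T1 c"
    by (elim insertE emptyE; simp add: order_bound_def cusp_order_def residue_set_defs)+
qed

lemma defect_order:
  assumes c: "c \<in> {0..59}" and cd: "primitive c d"
  shows "defect_order_ge c d (order_bound c)"
proof -
  have cop: "\<forall>u\<in>{1, 11, 7, 17, 13, 23, 19, 29}. coprime u (60 :: int)" by code_simp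
  have u: "defect_order_ge u d (order_bound u)" if "u \<in> {1, 11, 7, 17, 13, 23, 19, 29}" for u d
  proof (rule defect_order_right)
    show "coprime u 60" using cop that by blast
    show "defect_order_ge u 0 (order_bound u)"
      using that defect_order_units[of u] by (auto simp: order_bound_def)
  qed
  have "c \<in> {1, 11, 7, 17, 13, 23, 19, 29} \<or> 60 - c \<in> {1, 11, 7, 17, 13, 23, 19, 29}"
    if "c \<in> {1, 11, 49, 59, 7, 17, 43, 53, 19, 29, 31, 41, 13, 23, 37, 47}"
    using that by (elim insertE emptyE; simp)
  then consider "c \<in> {1, 11, 7, 17, 13, 23, 19, 29}" | "60 - c \<in> {1, 11, 7, 17, 13, 23, 19, 29}"
    | "c \<notin> {1, 11, 49, 59, 7, 17, 43, 53, 19, 29, 31, 41, 13, 23, 37, 47}"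
    by argo
  thus ?thesis
  proof cases
    case 1 thus ?thesis by (rule u)
  next
    case 2
    moreover have "60 - c = u \<Longrightarrow> c = 60 - u" for u by simp
    hence "order_bound (60 - c) = order_bound c"
      using 2 by (elim insertE emptyE) (force simp: order_bound_def)+
    ultimately show ?thesis using defect_order_reflect[of "60 - c" d] u[OF 2, of "- d"] by simp
  next
    case 3
    thus ?thesis using order_bound_le_cusp_order[OF c] by (intro defect_order_generic cd)
  qed
qed

section \<open>Vanishing of the defect\<close>

lemma primitive_alt: "primitive c d \<longleftrightarrow> gcd (gcd c d) 60 = 1"
  by (simp add: primitive_def gcd.assoc)

lemma primitive_translate: "primitive c (c + d) \<longleftrightarrow> primitive c d"
  by (simp add: primitive_alt)

lemma primitive_inversion: "primitive d (- c) \<longleftrightarrow> primitive c d"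
  by (simp add: primitive_alt gcd.commute)

lemma primitive_mod: "primitive c (d mod 60) \<longleftrightarrow> primitive c d" "primitive (c mod 60) d \<longleftrightarrow> primitive c d"
proof -
  show 1: "primitive c (d mod 60) \<longleftrightarrow> primitive c d" for c d
    by (simp add: primitive_def gcd_mod_left)
  have sym: "primitive c d \<longleftrightarrow> primitive d c" for c d by (simp add: primitive_alt gcd.commute)
  show "primitive (c mod 60) d \<longleftrightarrow> primitive c d"
    using 1[of d c] sym[of "c mod 60" d] sym[of c d] by simp
qed

definition primitive_rows :: "(int \<times> int) set" where
  "primitive_rows = {(c, d). c \<in> {0..59} \<and> d \<in> {0..59} \<and> primitive c d}"

lemma finite_primitive_rows: "finite primitive_rows"
  by (rule finite_subset[of _ "{0..59} \<times> {0..59}"]) (auto simp: primitive_rows_def)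

text \<open>The norm from level 60 down to level one. The vectors (c, d) and (-c, -d) give the same
  function, so each member of the family enters twice, and the order count does the same.\<close>

definition defect_norm :: "complex \<Rightarrow> complex" where
  "defect_norm t = (\<Prod>(c, d)\<in>primitive_rows. defect c d t)"

lemma mod_60_in: "(n::int) mod 60 \<in> {0..59}"
  using pos_mod_bound[of 60 n] pos_mod_sign[of 60 n] by simp

text \<open>Translation and inversion act on the index vectors by (c, d) -> (c, c + d) and (c, d) ->
  (d, -c), which are bijections of the primitive vectors modulo 60 and so only reorder the
  factors.\<close>

lemma defect_norm_translate:
  assumes t: "Im t > 0"
  shows "defect_norm (t + 1) = defect_norm t"
  unfolding defect_norm_def
proof (rule prod.reindex_bij_witness[of _ "\<lambda>(c, d). (c, (d - c) mod 60)" "\<lambda>(c, d). (c, (c + d) mod 60)"])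
  fix v :: "int \<times> int" assume "v \<in> primitive_rows"
  then obtain c d where v: "v = (c, d)" "c \<in> {0..59}" "d \<in> {0..59}" "primitive c d" by (auto simp: primitive_rows_def)
  have d: "d mod 60 = d" using v by simp
  have "((c + d) mod 60 - c) mod 60 = d mod 60" "(c + (d - c) mod 60) mod 60 = d mod 60" by (simp_all add: mod_simps)
  thus "(case case v of (c, d) \<Rightarrow> (c, (c + d) mod 60) of (c, d) \<Rightarrow> (c, (d - c) mod 60)) = v"
    "(case case v of (c, d) \<Rightarrow> (c, (d - c) mod 60) of (c, d) \<Rightarrow> (c, (c + d) mod 60)) = v"
    using d by (simp_all add: v)
  show "(case v of (c, d) \<Rightarrow> (c, (c + d) mod 60)) \<in> primitive_rows"
    using v mod_60_in[of "c + d"] by (simp add: primitive_rows_def primitive_mod primitive_translate)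
  show "(case v of (c, d) \<Rightarrow> (c, (d - c) mod 60)) \<in> primitive_rows"
    using v mod_60_in[of "d - c"] primitive_translate[of c "d - c"] by (simp add: primitive_rows_def primitive_mod)
  show "(case case v of (c, d) \<Rightarrow> (c, (c + d) mod 60) of (c, d) \<Rightarrow> defect c d t) = (case v of (c, d) \<Rightarrow> defect c d (t + 1))"
    by (simp add: v defect_translate defect_mod[OF t])
qed

lemma defect_norm_inversion:
  assumes t: "Im t > 0"
  shows "defect_norm (- 1 / t) = defect_norm t"
  unfolding defect_norm_def
proof (rule prod.reindex_bij_witness[of _ "\<lambda>(c, d). ((- d) mod 60, c)" "\<lambda>(c, d). (d, (- c) mod 60)"])
  fix v :: "int \<times> int" assume "v \<in> primitive_rows"
  then obtain c d where v: "v = (c, d)" "c \<in> {0..59}" "d \<in> {0..59}" "primitive c d" by (auto simp: primitive_rows_def)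
  have "x mod 60 = x" if "x \<in> {0..59}" for x :: int using that by simp
  hence eq: "(- ((- c) mod 60)) mod 60 = c" "(- ((- d) mod 60)) mod 60 = d"
    using v by (simp_all only: mod_minus_eq minus_minus)
  show "(case case v of (c, d) \<Rightarrow> (d, (- c) mod 60) of (c, d) \<Rightarrow> ((- d) mod 60, c)) = v"
    unfolding v prod.case eq ..
  show "(case case v of (c, d) \<Rightarrow> ((- d) mod 60, c) of (c, d) \<Rightarrow> (d, (- c) mod 60)) = v"
    unfolding v prod.case eq ..
  show "(case v of (c, d) \<Rightarrow> (d, (- c) mod 60)) \<in> primitive_rows"
    using v mod_60_in[of "- c"] by (simp add: primitive_rows_def primitive_mod primitive_inversion)
  have "primitive (- d) c" using v by (simp add: primitive_alt gcd.commute)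
  hence "primitive ((- d) mod 60) c" by (simp only: primitive_mod)
  thus "(case v of (c, d) \<Rightarrow> ((- d) mod 60, c)) \<in> primitive_rows"
    using v mod_60_in[of "- d"] by (simp add: primitive_rows_def)
  show "(case case v of (c, d) \<Rightarrow> (d, (- c) mod 60) of (c, d) \<Rightarrow> defect c d t) = (case v of (c, d) \<Rightarrow> defect c d (- 1 / t))"
    unfolding v prod.case defect_inversion[OF t] defect_mod[OF t] ..
qed

text \<open>The units give 60 (12 times 120 + 4 times 840) = 288000. The poles cost 16 times 7200,
  96 times 600, 48 times 1200 and 40 times 720, in all 259200.\<close>

lemma sum_order_bound: "(\<Sum>(c, d)\<in>primitive_rows. order_bound c) > 0"
proof -
  define m where "m c = card {d \<in> {0..59}. primitive c d}" for c
  have m_conv: "m c = length (filter (\<lambda>d. gcd c (gcd d 60) = 1) [0..59])" for c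
  proof -
    have "{d \<in> {0..59}. primitive c d} = set (filter (\<lambda>d. gcd c (gcd d 60) = 1) [0..59])"
      by (auto simp: primitive_def)
    thus ?thesis unfolding m_def by (simp only: distinct_card distinct_filter distinct_upto)
  qed
  have r: "primitive_rows = (SIGMA c:{0..59}. {d \<in> {0..59}. primitive c d})" by (auto simp: primitive_rows_def)
  have "(\<Sum>(c, d)\<in>primitive_rows. order_bound c) = (\<Sum>c\<in>{0..59}. \<Sum>d\<in>{d \<in> {0..59}. primitive c d}. order_bound c)"
    unfolding r by (subst sum.Sigma) (auto intro: finite_subset[of _ "{0..59}"])
  also have "\<dots> = (\<Sum>c\<in>{0..59}. int (m c) * order_bound c)" by (simp add: m_def)
  also have "\<dots> = (\<Sum>c\<in>{1, 11, 49, 59, 7, 17, 43, 53, 19, 29, 31, 41, 13, 23, 37, 47, 0, 5, 55, 10, 50, 18, 42}.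
      int (m c) * order_bound c)"
    by (rule sum.mono_neutral_right) (auto simp: order_bound_def)
  also have "\<dots> = 28800"
  proof -
    have "\<forall>u\<in>{1, 11, 49, 59, 7, 17, 43, 53, 19, 29, 31, 41, 13, 23, 37, 47}. coprime u (60 :: int)"
      by code_simp
    moreover have "m u = 60" if "coprime u 60" for u
    proof -
      have "gcd u (gcd d 60) = 1" for d
      proof -
        have "gcd u (gcd d 60) = gcd d (gcd u 60)" by (rule gcd.left_commute)
        also have "gcd u 60 = 1" using that by (simp only: coprime_iff_gcd_eq_1)
        finally show ?thesis by simp
      qed
      hence "{d \<in> {0..59}. primitive u d} = {0..59}" by (auto simp: primitive_def)
      thus ?thesis by (simp add: m_def)
    qed
    ultimately have u: "\<forall>u\<in>{1, 11, 49, 59, 7, 17, 43, 53, 19, 29, 31, 41, 13, 23, 37, 47}. m u = 60"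
      by blast
    \<comment> \<open>The number of admissible d is 60 times the product of 1 - 1/p over the primes
      p dividing gcd(c, 60).\<close>
    have counts: "map (\<lambda>c::int. sum_list (map (\<lambda>d. if gcd c (gcd d 60) = 1 then 1 else 0 :: int) [0..59]))
        [0, 5, 55, 10, 50, 18, 42] = [16, 48, 48, 24, 24, 20, 20]"
      by code_simp
    have conv: "sum_list (map (\<lambda>d. if P d then 1 else 0 :: int) xs) = int (length (filter P xs))" for P and xs :: "int list"
      by (induction xs) auto
    have "map (\<lambda>c. int (m c)) [0, 5, 55, 10, 50, 18, 42] = [16, 48, 48, 24, 24, 20, 20]"
      using counts unfolding conv m_conv .
    hence "m 0 = 16" "m 5 = 48" "m 55 = 48" "m 10 = 24" "m 50 = 24" "m 18 = 20" "m 42 = 20"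
      by simp_all
    thus ?thesis using u by (simp add: order_bound_def)
  qed
  finally show ?thesis by simp
qed

lemma defect_norm_cusp:
  assumes "e > 0"
  shows "\<exists>Y. \<forall>t. Im t > Y \<longrightarrow> norm (defect_norm t) < e"
proof -
  have "\<forall>v\<in>primitive_rows. \<exists>C\<ge>0. \<forall>t. Im t \<ge> 1 \<longrightarrow>
     norm (defect (fst v) (snd v) t) \<le> C * exp (- pi / 3600 * of_int (order_bound (fst v)) * Im t)"
  proof
    fix v assume "v \<in> primitive_rows"
    then obtain c d where "v = (c, d)" "c \<in> {0..59}" "primitive c d" by (auto simp: primitive_rows_def)
    thus "\<exists>C\<ge>0. \<forall>t. Im t \<ge> 1 \<longrightarrow>
        norm (defect (fst v) (snd v) t) \<le> C * exp (- pi / 3600 * of_int (order_bound (fst v)) * Im t)"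
      using defect_order[of c d] unfolding defect_order_ge_def by simp
  qed
  then obtain C where C: "\<And>v. v \<in> primitive_rows \<Longrightarrow> C v \<ge> 0"
    "\<And>v t. v \<in> primitive_rows \<Longrightarrow> Im t \<ge> 1 \<Longrightarrow>
      norm (defect (fst v) (snd v) t) \<le> C v * exp (- pi / 3600 * of_int (order_bound (fst v)) * Im t)"
    by metis
  define N where "N = (\<Sum>v\<in>primitive_rows. order_bound (fst v))"
  have N: "N > 0" using sum_order_bound by (simp add: N_def case_prod_unfold)
  define B where "B = (\<Prod>v\<in>primitive_rows. C v)"
  have B: "B \<ge> 0" unfolding B_def using C by (intro prod_nonneg) auto
  have bound: "norm (defect_norm t) \<le> B * exp (- (pi / 3600 * of_int N) * Im t)" if t: "Im t \<ge> 1" for t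
  proof -
    have "norm (defect_norm t) = (\<Prod>v\<in>primitive_rows. norm (defect (fst v) (snd v) t))"
      by (simp add: defect_norm_def prod_norm case_prod_unfold)
    also have "\<dots> \<le> (\<Prod>v\<in>primitive_rows. C v * exp (- pi / 3600 * of_int (order_bound (fst v)) * Im t))"
      using C t by (intro prod_mono) auto
    also have "\<dots> = B * exp (\<Sum>v\<in>primitive_rows. - pi / 3600 * of_int (order_bound (fst v)) * Im t)"
      by (simp add: B_def prod.distrib exp_sum finite_primitive_rows)
    also have "(\<Sum>v\<in>primitive_rows. - pi / 3600 * of_int (order_bound (fst v)) * Im t) = - (pi / 3600 * of_int N) * Im t"
      by (simp add: N_def sum_distrib_left sum_distrib_right sum_negf)
    finally show ?thesis .
  qed
  \<comment> \<open>Positivity of \<open>N\<close> enters here: total order 0 would only give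
    boundedness at the cusp.\<close>
  have "((\<lambda>y. B * exp (- (pi / 3600 * of_int N) * y)) \<longlongrightarrow> B * 0) at_top"
  proof (intro tendsto_mult tendsto_const filterlim_compose[OF exp_at_bot])
    have "filterlim (\<lambda>y. pi / 3600 * real_of_int N * y) at_top at_top"
      using N by (intro filterlim_tendsto_pos_mult_at_top[OF tendsto_const _ filterlim_ident]) auto
    thus "filterlim (\<lambda>y. - (pi / 3600 * real_of_int N) * y) at_bot at_top"
      by (simp add: filterlim_uminus_at_bot)
  qed
  hence "eventually (\<lambda>y. B * exp (- (pi / 3600 * of_int N) * y) < e) at_top"
    using assms by (intro order_tendstoD) auto
  then obtain Y where Y: "\<And>y. y \<ge> Y \<Longrightarrow> B * exp (- (pi / 3600 * of_int N) * y) < e"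
    by (auto simp: eventually_at_top_linorder)
  show ?thesis
  proof (intro exI[of _ "max Y 1"] allI impI)
    fix t :: complex assume "Im t > max Y 1"
    thus "norm (defect_norm t) < e" using bound[of t] Y[of "Im t"] by simp
  qed
qed

lemma defect_norm_eq_0:
  assumes "Im t > 0"
  shows "defect_norm t = 0"
proof (rule modular_vanishing_at_cusp_imp_zero[OF _ _ _ _ assms])
  show "defect_norm holomorphic_on {t. Im t > 0}"
    unfolding defect_norm_def[abs_def] case_prod_unfold
    by (intro holomorphic_on_prod holomorphic_on_defect) (auto simp: primitive_rows_def)
qed (auto simp: defect_norm_translate defect_norm_inversion[simplified] defect_norm_cusp)

lemma defect_zero_exists: "\<exists>c d. primitive c d \<and> (\<forall>t. Im t > 0 \<longrightarrow> defect c d t = 0)"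
proof -
  have "\<exists>v\<in>primitive_rows. \<forall>t\<in>{t. Im t > 0}. (case v of (c, d) \<Rightarrow> defect c d) t = 0"
  proof (rule holomorphic_prod_eq_0_imp_factor_eq_0[OF finite_primitive_rows open_halfspace_Im_gt])
    show "connected {t. Im t > 0}" by (simp add: convex_connected convex_halfspace_Im_gt)
    have "\<i> \<in> {t. Im t > 0}" by simp
    thus "{t. Im t > 0} \<noteq> {}" by blast
    show "(case v of (c, d) \<Rightarrow> defect c d) holomorphic_on {t. Im t > 0}" if "v \<in> primitive_rows" for v
      using that holomorphic_on_defect by (auto simp: primitive_rows_def)
    show "(\<Prod>v\<in>primitive_rows. (case v of (c, d) \<Rightarrow> defect c d) t) = 0" if "t \<in> {t. Im t > 0}" for t
      using defect_norm_eq_0[of t] that by (simp add: defect_norm_def case_prod_unfold)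
  qed
  thus ?thesis by (auto simp: primitive_rows_def)
qed

section \<open>From one vanishing member to all unit vectors\<close>

definition vanishing :: "int \<Rightarrow> int \<Rightarrow> bool" where
  "vanishing c d \<longleftrightarrow> (\<forall>t. Im t > 0 \<longrightarrow> defect c d t = 0)"

lemma vanishing_right: "vanishing c d \<Longrightarrow> vanishing c (d + m * c)"
  unfolding vanishing_def
proof (intro allI impI)
  fix t :: complex assume "\<forall>t. Im t > 0 \<longrightarrow> defect c d t = 0" "Im t > 0"
  thus "defect c (d + m * c) t = 0" using defect_translate_int[of c d t m] by simp
qed

lemma vanishing_rotate: "vanishing c d \<Longrightarrow> vanishing d (- c)"
  unfolding vanishing_def
proof (intro allI impI)
  fix t :: complex assume v: "\<forall>t. Im t > 0 \<longrightarrow> defect c d t = 0" and t: "Im t > 0"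
  have "Im (- 1 / t) > 0" using t by (simp add: Im_divide sum_power2_gt_zero_iff)
  hence "defect c d (- 1 / t) = 0" using v by blast
  thus "defect d (- c) t = 0" unfolding defect_inversion[OF t] .
qed

lemma vanishing_minus: "vanishing c d \<Longrightarrow> vanishing (- c) (- d)"
  by (simp add: vanishing_def defect_minus)

text \<open>The shift of the second entry conjugated by the rotation: (c, d), (d, -c), (d, -c - md),
  (-c - md, -d), (c + md, d).\<close>

lemma vanishing_left: "vanishing c d \<Longrightarrow> vanishing (c + m * d) d"
  using vanishing_minus[OF vanishing_rotate[OF vanishing_right[OF vanishing_rotate[of c d], of "- m"]]]
  by (simp add: algebra_simps)

lemma vanishing_mod: "d mod 60 = d' mod 60 \<Longrightarrow> vanishing c d \<Longrightarrow> vanishing c d'"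
  unfolding vanishing_def using defect_mod(2) by metis

text \<open>Euclid's algorithm over the integers, each division step being a shift followed by a
  rotation.\<close>

lemma vanishing_gcd: "vanishing c d \<Longrightarrow> vanishing (gcd c d) 0"
proof (induction "nat \<bar>d\<bar>" arbitrary: c d rule: less_induct)
  case less
  show ?case
  proof (cases "d = 0")
    case True
    thus ?thesis using less.prems vanishing_minus[of c 0] by (cases "c \<ge> 0") auto
  next
    case False
    have "vanishing (c + - (c div d) * d) d" by (rule vanishing_left[OF less.prems])
    also have "c + - (c div d) * d = c mod d" by (simp add: minus_div_mult_eq_mod[symmetric])
    finally have "vanishing d (- (c mod d))" by (rule vanishing_rotate)
    moreover have "nat \<bar>- (c mod d)\<bar> < nat \<bar>d\<bar>" using False abs_mod_less[of d c] by simp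
    ultimately have "vanishing (gcd d (- (c mod d))) 0" by (intro less.hyps)
    moreover have "gcd d (- (c mod d)) = gcd c d" using gcd_red_int[of c d] by simp
    ultimately show ?thesis by simp
  qed
qed

text \<open>With g = gcd(c, d), which is coprime to 60, the path is (g, 0), (g, 1), (u, 1), (u, 0):
  the first and last steps use inverses modulo 60, the middle one adds u - g times the second
  entry.\<close>

lemma vanishing_unit:
  assumes "coprime u 60"
  shows "vanishing u 0"
proof -
  obtain c d where cd: "primitive c d" "vanishing c d"
    using defect_zero_exists unfolding vanishing_def by blast
  define g where "g = gcd c d"
  have g: "coprime g 60" "vanishing g 0"
    using cd vanishing_gcd by (auto simp: g_def primitive_alt coprime_iff_gcd_eq_1)
  obtain m where m: "[g * m = 1] (mod 60)" using cong_solve_coprime_int[OF g(1)] by blast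
  have "vanishing g (0 + m * g)" using g by (intro vanishing_right)
  hence "vanishing g 1"
    using m by (intro vanishing_mod[of "0 + m * g" 1 g]) (simp_all add: unique_euclidean_semiring_class.cong_def mult.commute)
  hence u1: "vanishing u 1" using vanishing_left[of g 1 "u - g"] by simp
  obtain n where n: "[u * n = 1] (mod 60)" using cong_solve_coprime_int[OF assms] by blast
  have "vanishing u (1 + (- n) * u)" using u1 by (rule vanishing_right)
  moreover have "(1 + (- n) * u) mod 60 = 0 mod 60"
    using cong_diff[OF cong_refl[of 1] n] by (simp add: unique_euclidean_semiring_class.cong_def mult.commute)
  ultimately show ?thesis using vanishing_mod by blast
qed

section \<open>The partition identities\<close>

text \<open>The units 1, 7, 13, 19 represent the four cosets, so the vanishing of their defects
  gives the four power series identities.\<close>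

lemma discrepancies_eq_0:
  "discrepancy S1 T1 1 0 n = 0" "discrepancy S2 T2 0 8 n = 0"
  "discrepancy S3 T3 6 0 n = 0" "discrepancy S4 T4 3 0 n = 0"
proof -
  have "\<forall>u\<in>{1, 7, 13, 19}. coprime u (60 :: int)" by code_simp
  hence v: "vanishing 1 0" "vanishing 7 0" "vanishing 13 0" "vanishing 19 0"
    using vanishing_unit by blast+
  show "discrepancy S1 T1 1 0 n = 0"
  proof (rule discrepancy_eq_0[OF residue_sets_subset(1,2)])
    fix t :: complex assume "Im t > 0"
    thus "siegel_quotient S1 1 0 t - siegel_quotient T1 1 0 t - 1 = 0"
      using v(1) defect_units(1)[of t 1] by (simp add: vanishing_def)
  qed (use cusp_order_at_1 discrepancy_0[OF residue_sets_subset(1)] in auto)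
  show "discrepancy S2 T2 0 8 n = 0"
  proof (rule discrepancy_eq_0[OF residue_sets_subset(3,4)])
    fix t :: complex assume "Im t > 0"
    thus "siegel_quotient S2 1 0 t - siegel_quotient T2 1 0 t - 1 = 0"
      using v(2) defect_units(2)[of t 7] by (simp add: vanishing_def)
  qed (use cusp_order_at_1 discrepancy_2 in auto)
  show "discrepancy S3 T3 6 0 n = 0"
  proof (rule discrepancy_eq_0[OF residue_sets_subset(5,6)])
    fix t :: complex assume "Im t > 0"
    thus "siegel_quotient S3 1 0 t - siegel_quotient T3 1 0 t - 1 = 0"
      using v(3) defect_units(3)[of t 13] by (simp add: vanishing_def)
  qed (use cusp_order_at_1 discrepancy_0[OF residue_sets_subset(5)] in auto)
  show "discrepancy S4 T4 3 0 n = 0"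
  proof (rule discrepancy_eq_0[OF residue_sets_subset(7,8)])
    fix t :: complex assume "Im t > 0"
    thus "siegel_quotient S4 1 0 t - siegel_quotient T4 1 0 t - 1 = 0"
      using v(4) defect_units(4)[of t 19] by (simp add: vanishing_def)
  qed (use cusp_order_at_1 discrepancy_0[OF residue_sets_subset(7)] in auto)
qed

theorem theorem12p7:
  shows
    "(let S = pm_residues {1, 4, 7, 10, 11, 13, 17, 18, 19, 24, 25, 27} 60;
          T = pm_residues {1, 3, 7, 10, 11, 16, 17, 18, 23, 24, 25, 29} 60
      in \<forall>n\<ge>1. num_partitions S n = num_partitions T (n - 1)) \<and>
     (let S = pm_residues {1, 5, 6, 7, 8, 10, 11, 12, 17, 19, 21, 23} 60;
          T = pm_residues {1, 5, 6, 7, 9, 10, 11, 12, 13, 17, 28, 29} 60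
      in \<forall>n. n \<noteq> 8 \<longrightarrow> num_partitions S n = num_partitions T n) \<and>
     (let S = pm_residues {6, 7, 8, 9, 10, 11, 12, 13, 19, 23, 25, 29} 60;
          T = pm_residues {1, 6, 10, 12, 13, 17, 19, 21, 23, 25, 28, 29} 60
      in \<forall>n\<ge>6. num_partitions S n = num_partitions T (n - 6)) \<and>
     (let S = pm_residues {3, 4, 5, 10, 11, 13, 17, 18, 19, 23, 24, 29} 60;
          T = pm_residues {1, 5, 7, 10, 13, 16, 18, 19, 23, 24, 27, 29} 60
      in \<forall>n\<ge>3. num_partitions S n = num_partitions T (n - 3))"
proof -
  have "num_partitions (pm_residues (int ` S1) 60) n = num_partitions (pm_residues (int ` T1) 60) (n - 1)"
    if "n \<ge> 1" for n
    using discrepancies_eq_0(1)[of n] that by (simp add: discrepancy_def)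
  moreover have "num_partitions (pm_residues (int ` S2) 60) n = num_partitions (pm_residues (int ` T2) 60) n"
    if "n \<noteq> 8" for n
    using discrepancies_eq_0(2)[of n] that by (simp add: discrepancy_def)
  moreover have "num_partitions (pm_residues (int ` S3) 60) n = num_partitions (pm_residues (int ` T3) 60) (n - 6)"
    if "n \<ge> 6" for n
    using discrepancies_eq_0(3)[of n] that by (simp add: discrepancy_def)
  moreover have "num_partitions (pm_residues (int ` S4) 60) n = num_partitions (pm_residues (int ` T4) 60) (n - 3)"
    if "n \<ge> 3" for n
    using discrepancies_eq_0(4)[of n] that by (simp add: discrepancy_def)
  ultimately show ?thesis by (simp add: residue_set_defs Let_def)
qed

end
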